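(* Let $d\ge 2$. For every fixed $d$-ary tree $D$, the limit $$\eta_d(D)=\lim_{n\to\infty}\gamma(D,H_n^d)$$ exists. It can be determined recursively as follows: $\eta_d(D)=1$ when $D$ is empty or consists of a single vertex. Otherwise, if $D_1,D_2,\ldots,D_d$ are the branches of $D$ (some possibly empty), then $$\eta_d(D)=\binom{\|D\|}{\|D_1\|,\|D_2\|,\ldots,\|D_d\|}\,\frac{|M(D)|}{d^{\|D\|}-d}\,\prod_{i=1}^d\eta_d(D_i).$$ Moreover, $$\gamma(D,H_n^d)=\eta_d(D)+O(n^{-1})$$ as $n\to\infty$, where the constant implied by the $O$-term depends only on $d$ and $D$.
   Context: A $d$-ary tree is a finite rooted tree in which every internal (non-leaf) vertex has at least two and at most $d$ children; a single vertex is a $d$-ary tree with one leaf, and the empty tree with $0$ leaves is also allowed. Isomorphism means root-preserving isomorphism (two empty trees are isomorphic). $\|T\|$ denotes the number of leaves of $T$. A set $S$ of leaves of $T$ induces a $d$-ary tree: take the smallest subtree of $T$ containing all leaves in $S$ (rooted at the most recent common ancestor of $S$) and repeatedly suppress every vertex with exactly one child (contracting its two adjacent edges to a single edge). $c(D,T)$ is the number of sets of $\|D\|$ leaves of $T$ that induce a tree isomorphic to $D$ (with $c(D,T)=1$ if $D$ is empty), and $\gamma(D,T)=c(D,T)/\binom{\|T\|}{\|D\|}$. The branches of a $d$-ary tree $D$ with at least two leaves are the components (rooted at the children of the root) obtained on removing the root; the list is padded with empty trees to have exactly $d$ entries $D_1,\ldots,D_d$. On the set of permutations of $[d]=\{1,\ldots,d\}$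 define $\pi\sim_D\pi'$ if $D_{\pi(j)}$ is isomorphic to $D_{\pi'(j)}$ for every $j\in[d]$; $M(D)$ is a complete set of representatives of the equivalence classes of $\sim_D$. The strictly $d$-ary trees $H_n^d$ ($n\ge 0$) are defined recursively: $H_0^d$ is a single leaf; for $n>0$ write $n-1=ds+b$ with $b\in\{0,1,\ldots,d-1\}$, take $d-b$ copies of $H_s^d$ and $b$ copies of $H_{s+1}^d$, and connect a new common root to each of their roots by an edge to obtain $H_n^d$. The tree $H_n^d$ has $(d-1)n+1$ leaves. *)

theory Defs
  imports
    Complex_Main
    "HOL-Library.Landau_Symbols"
    "HOL-Library.Sublist"
    "HOL-Combinatorics.Permutations"
begin

text \<open>
  Nonempty finite rooted trees, up to isomorphism. The order in which children are listed is only a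
  device for naming vertices: a vertex is the list of child indices on the path to it from the root
  \<^term>\<open>[]\<close>. Isomorphism, defined below, ignores this order.
\<close>

datatype rtree = Node "rtree list"

abbreviation Leaf :: rtree where
  "Leaf \<equiv> Node []"

text \<open>The value \<^term>\<open>None\<close> stands for the empty tree.\<close>

type_synonym tree = "rtree option"

lemma size_nth_less [termination_simp]:
  "i < length ts \<Longrightarrow> size (ts ! i) < Suc (size_list size ts)"
  by (metis less_Suc_eq_le nth_mem order_refl size_list_estimation')

fun positions :: "rtree \<Rightarrow> nat list set" where
  "positions (Node ts) = insert [] (\<Union>i<length ts. (#) i ` positions (ts ! i))"

fun verts :: "tree \<Rightarrow> nat list set" where
  "verts None = {}"
| "verts (Some t) = positions t"

definition children :: "tree \<Rightarrow> nat list \<Rightarrow> nat list set" where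
  "children T p = {q \<in> verts T. \<exists>i. q = p @ [i]}"

definition leaves :: "tree \<Rightarrow> nat list set" where
  "leaves T = {p \<in> verts T. children T p = {}}"

definition nleaves :: "tree \<Rightarrow> nat" where
  "nleaves T = card (leaves T)"

definition dary :: "nat \<Rightarrow> tree \<Rightarrow> bool" where
  "dary d T \<longleftrightarrow>
     (\<forall>p\<in>verts T. p \<notin> leaves T \<longrightarrow> 2 \<le> card (children T p) \<and> card (children T p) \<le> d)"

definition adjacent :: "tree \<Rightarrow> nat list \<Rightarrow> nat list \<Rightarrow> bool" where
  "adjacent T p q \<longleftrightarrow>
     p \<in> verts T \<and> q \<in> verts T \<and> (q \<in> children T p \<or> p \<in> children T q)"

text \<open>
  Since \<^term>\<open>[]\<close> is the root of every nonempty tree, \<^term>\<open>f [] = []\<close> says that the root is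
  preserved; for two empty trees the condition is vacuous, as \<^term>\<open>f\<close> is arbitrary off the vertices.
\<close>

definition iso :: "tree \<Rightarrow> tree \<Rightarrow> bool" where
  "iso T U \<longleftrightarrow>
     (\<exists>f. bij_betw f (verts T) (verts U) \<and> f [] = [] \<and>
          (\<forall>p\<in>verts T. \<forall>q\<in>verts T. adjacent T p q \<longleftrightarrow> adjacent U (f p) (f q)))"


subsection \<open>Induced trees\<close>

fun subtree_at :: "rtree \<Rightarrow> nat list \<Rightarrow> rtree" where
  "subtree_at t [] = t"
| "subtree_at (Node ts) (i # p) = subtree_at (ts ! i) p"

text \<open>
  \<^term>\<open>prune t S\<close> is the smallest subtree of \<^term>\<open>t\<close> that contains the root and all of \<^term>\<open>S\<close>:
  it keeps exactly the vertices that lie on a path from the root to a member of \<^term>\<open>S\<close>.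
  The kept children are renumbered consecutively.
\<close>

function prune :: "rtree \<Rightarrow> nat list set \<Rightarrow> rtree" where
  "prune (Node ts) S =
     Node (map (\<lambda>i. prune (ts ! i) {p. i # p \<in> S})
               (filter (\<lambda>i. \<exists>p. i # p \<in> S) [0..<length ts]))"
  by pat_completeness auto
termination
  by (relation "measure (\<lambda>(t, S). size t)") (auto simp: size_nth_less)

text \<open>Suppression of every vertex with exactly one child:\<close>

fun suppress :: "rtree \<Rightarrow> rtree" where
  "suppress (Node [t]) = suppress t"
| "suppress (Node ts) = Node (map suppress ts)"

text \<open>
  The longest common prefix of a nonempty set \<^term>\<open>S\<close> of vertices is their most recent common
  ancestor \<^term>\<open>m\<close>; the members of \<^term>\<open>S\<close> are then renamed relative to the subtree rooted there.
\<close>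

fun induced :: "tree \<Rightarrow> nat list set \<Rightarrow> tree" where
  "induced None S = None"
| "induced (Some t) S =
     (if S = {} then None
      else let m = Longest_common_prefix S
           in Some (suppress (prune (subtree_at t m) {p. m @ p \<in> S})))"

text \<open>
  For empty \<^term>\<open>D\<close> the only candidate is \<^term>\<open>S = {}\<close>, so that \<^term>\<open>copies D T = 1\<close>.
\<close>

definition copies :: "tree \<Rightarrow> tree \<Rightarrow> nat" where
  "copies D T = card {S. S \<subseteq> leaves T \<and> card S = nleaves D \<and> iso (induced T S) D}"

definition density :: "tree \<Rightarrow> tree \<Rightarrow> real" where
  "density D T = real (copies D T) / real (nleaves T choose nleaves D)"


subsection \<open>Branches\<close>

fun branches :: "nat \<Rightarrow> tree \<Rightarrow> tree list" where
  "branches d None = replicate d None"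
| "branches d (Some (Node ts)) = map Some ts @ replicate (d - length ts) None"

text \<open>Branches are numbered from \<open>0\<close> to \<open>d - 1\<close>, so permutations act on \<^term>\<open>{..<d}\<close>.\<close>

definition perm_sim :: "nat \<Rightarrow> tree \<Rightarrow> (nat \<Rightarrow> nat) \<Rightarrow> (nat \<Rightarrow> nat) \<Rightarrow> bool" where
  "perm_sim d D \<pi> \<pi>' \<longleftrightarrow> (\<forall>j<d. iso (branches d D ! \<pi> j) (branches d D ! \<pi>' j))"

text \<open>\<^term>\<open>M\<close> is a complete set of representatives of the classes of \<^term>\<open>perm_sim d D\<close>:\<close>

definition perm_reps :: "nat \<Rightarrow> tree \<Rightarrow> (nat \<Rightarrow> nat) set \<Rightarrow> bool" where
  "perm_reps d D M \<longleftrightarrow>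
     M \<subseteq> {\<pi>. \<pi> permutes {..<d}} \<and>
     (\<forall>\<pi>. \<pi> permutes {..<d} \<longrightarrow> (\<exists>!\<pi>'. \<pi>' \<in> M \<and> perm_sim d D \<pi> \<pi>'))"

definition multinomial :: "nat \<Rightarrow> (nat \<Rightarrow> nat) \<Rightarrow> nat \<Rightarrow> real" where
  "multinomial n k r = fact n / (\<Prod>i<r. fact (k i))"


subsection \<open>The strictly d-ary trees and the limit density\<close>

text \<open>
  The guard \<^term>\<open>b = 0\<close> is only there for termination: the copies of the tree with index
  \<^term>\<open>Suc s\<close> are needed only if \<^term>\<open>b > 0\<close>.
\<close>

function H :: "nat \<Rightarrow> nat \<Rightarrow> rtree" where
  "H d 0 = Leaf"
| "H d (Suc m) =
     (let s = m div d; b = m mod d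
      in Node (replicate (d - b) (H d s) @ (if b = 0 then [] else replicate b (H d (Suc s)))))"
  by pat_completeness auto
termination
proof (relation "measure snd", goal_cases)
  case (3 d m s b)
  then have "m mod d \<noteq> 0" by simp
  then have "m \<noteq> 0" and "d \<noteq> 1" by (metis mod_0, metis mod_by_1)
  then have "m div d < m"
    by (cases "d = 0") (auto intro: div_less_dividend)
  then show ?case using 3 by simp
qed (auto simp: less_Suc_eq_le)

definition \<eta> :: "nat \<Rightarrow> tree \<Rightarrow> real" where
  "\<eta> d D = lim (\<lambda>n. density D (Some (H d n)))"

end

theory Submission
  imports Defs "HOL-Combinatorics.Multiset_Permutations"
begin

text \<open>
  A set of leaves of a tree lies either in one branch or is spread over several, and in the latter
  case the branches of the induced tree are induced by the parts of the set. Hence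
  \<open>c(D, H_n)\<close> is the sum of \<open>c(D, T)\<close> over the \<open>d\<close> branches \<open>T\<close> of \<open>H_n\<close>, plus a sum over the
  distinct arrangements of the branches of \<open>D\<close> of products of smaller counts. By induction on \<open>D\<close>
  these products are \<open>C (n/d)^k + O(n^(k-1))\<close>, where \<open>k\<close> is the number of leaves of \<open>D\<close>, and so
  \<open>c(D, H_n) = A n^k + O(n^(k-1))\<close> with \<open>A = d A / d^k + C / d^k\<close>. The error analysis needs
  \<open>k \<ge> 3\<close>; for \<open>k = 2\<close> every pair of leaves induces \<open>D\<close>, so that the density is \<open>1\<close>.
\<close>

subsection \<open>Isomorphism types of trees\<close>

text \<open>Replacing \<open>iso\<close> by equality of types turns the counted families of leaf
  sets into fibres of a function, and turns the classes of permutations into arrangements of one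
  multiset, whose number is |M(D)|. Counts are divided by n^k and not by the binomial coefficient,
  because powers of n multiply across branches. The change to densities costs a factor k!/(d-1)^k
  for D and l!/(d-1)^l for a branch with l leaves. As the l add up to k, the powers of d-1 cancel,
  and the factorials that remain are the multinomial coefficient of the formula. The obstacle is the
  rate. An error of order n^(k-1) in each of d branches of index about n/d returns multiplied by
  d^(2-k): a contraction for k at least 3, but a factor 1 for k = 2, where the recursion alone would
  allow errors of order n log n. Two leaves are therefore counted exactly, and the claimed formula
  has to be matched with that count, which needs the number of arrangements of two leaves among d
  branches.\<close>

text \<open>Isomorphism types of nonempty trees; the type of the empty tree is \<open>None\<close>.\<close>

datatype mtree = MNode "mtree multiset"

primrec canon :: "rtree \<Rightarrow> mtree" where
  "canon (Node ts) = MNode (mset (map canon ts))"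

primrec mleaves :: "mtree \<Rightarrow> nat" where
  "mleaves (MNode X) = (if X = {#} then 1 else sum_mset (image_mset mleaves X))"

text \<open>The recursive values arrive as a multiset of truth values, all of which must hold;
  \<open>mdary\<close> has the same shape.\<close>

primrec no_unary :: "mtree \<Rightarrow> bool" where
  "no_unary (MNode X) \<longleftrightarrow> size X \<noteq> 1 \<and> (\<forall>b \<in># image_mset no_unary X. b)"

primrec mdary :: "nat \<Rightarrow> mtree \<Rightarrow> bool" where
  "mdary d (MNode X) \<longleftrightarrow>
     (X = {#} \<or> 2 \<le> size X \<and> size X \<le> d) \<and> (\<forall>b \<in># image_mset (mdary d) X. b)"

lemma Nil_in_positions [simp]: "[] \<in> positions t"
  by (cases t) simp

lemma Cons_in_positions [simp]:
  "i # p \<in> positions (Node ts) \<longleftrightarrow> i < length ts \<and> p \<in> positions (ts ! i)"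
  by auto

declare positions.simps [simp del]

lemma children_Cons:
  assumes "i < length ts"
  shows "children (Some (Node ts)) (i # p) = (#) i ` children (Some (ts ! i)) p"
  using assms by (auto simp: children_def image_iff)

lemma children_Nil: "children (Some (Node ts)) [] = (\<lambda>i. [i]) ` {..<length ts}"
  by (auto simp: children_def image_iff)

lemma Nil_in_leaves: "[] \<in> leaves (Some (Node ts)) \<longleftrightarrow> ts = []"
  by (auto simp: leaves_def children_Nil)

lemma Cons_in_leaves [simp]:
  "i # p \<in> leaves (Some (Node ts)) \<longleftrightarrow> i < length ts \<and> p \<in> leaves (Some (ts ! i))"
  by (auto simp: leaves_def children_Cons)

lemma leaves_Node:
  "leaves (Some (Node ts)) =
     (if ts = [] then {[]} else (\<Union>i<length ts. (#) i ` leaves (Some (ts ! i))))"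
  (is "_ = ?R")
proof (intro set_eqI)
  fix p show "p \<in> leaves (Some (Node ts)) \<longleftrightarrow> p \<in> ?R"
    by (cases p) (auto simp: Nil_in_leaves)
qed

lemma finite_leaves [simp]: "finite (leaves (Some t))"
proof (induction t)
  case (Node ts)
  then show ?case by (simp add: leaves_Node)
qed

lemma nleaves_Node:
  "nleaves (Some (Node ts)) = (if ts = [] then 1 else (\<Sum>i<length ts. nleaves (Some (ts ! i))))"
proof -
  have "card (\<Union>i<length ts. (#) i ` leaves (Some (ts ! i)))
      = (\<Sum>i<length ts. card ((#) i ` leaves (Some (ts ! i))))"
    by (rule card_UN_disjoint) auto
  then show ?thesis
    by (simp add: nleaves_def leaves_Node card_image)
qed

lemma mleaves_canon: "mleaves (canon t) = nleaves (Some t)"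
proof (induction t)
  case (Node ts)
  have "(\<Sum>x\<leftarrow>ts. mleaves (canon x)) = (\<Sum>i<length ts. nleaves (Some (ts ! i)))"
    by (auto simp: sum_list_sum_nth atLeast0LessThan Node intro!: sum.cong)
  then show ?case
    by (auto simp: nleaves_Node image_mset.compositionality o_def simp flip: sum_mset_sum_list)
qed

lemma mdary_canon:
  assumes "dary d (Some t)"
  shows "mdary d (canon t)"
  using assms
proof (induction t)
  case (Node ts)
  have "mdary d (canon t)" if "t \<in> set ts" for t
  proof (rule Node.IH[OF that])
    obtain i where i: "i < length ts" "t = ts ! i"
      using \<open>t \<in> set ts\<close> by (metis in_set_conv_nth)
    show "dary d (Some t)"
      unfolding dary_def
    proof (intro ballI impI)
      fix p assume p: "p \<in> verts (Some t)" "p \<notin> leaves (Some t)"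
      then have "i # p \<in> verts (Some (Node ts))" "i # p \<notin> leaves (Some (Node ts))"
        using i by auto
      with Node.prems have "2 \<le> card (children (Some (Node ts)) (i # p)) \<and>
          card (children (Some (Node ts)) (i # p)) \<le> d"
        unfolding dary_def by blast
      then show "2 \<le> card (children (Some t) p) \<and> card (children (Some t) p) \<le> d"
        using i by (simp add: children_Cons card_image)
    qed
  qed
  moreover have "ts = [] \<or> 2 \<le> length ts \<and> length ts \<le> d"
  proof (cases "ts = []")
    case False
    then have "[] \<in> verts (Some (Node ts))" "[] \<notin> leaves (Some (Node ts))"
      by (auto simp: Nil_in_leaves)
    with Node.prems have "2 \<le> card (children (Some (Node ts)) []) \<and>
        card (children (Some (Node ts)) []) \<le> d"
      unfolding dary_def by blast
    moreover have "card (children (Some (Node ts)) []) = length ts"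
      by (simp add: children_Nil card_image inj_on_def)
    ultimately show ?thesis by simp
  qed simp
  ultimately show ?case by auto
qed

lemma mdary_imp_no_unary: "mdary d m \<Longrightarrow> no_unary m"
  by (induction m) auto

section \<open>Graph isomorphism as equality of types\<close>

lemma adjacent_sym: "adjacent T p q \<longleftrightarrow> adjacent T q p"
  by (auto simp: adjacent_def)

lemma adjacent_Cons:
  "adjacent (Some (Node ts)) (i # p) (i # q) \<longleftrightarrow> i < length ts \<and> adjacent (Some (ts ! i)) p q"
  by (auto simp: adjacent_def children_Cons)

lemma adjacent_Cons_neq:
  "i \<noteq> j \<Longrightarrow> \<not> adjacent (Some (Node ts)) (i # p) (j # q)"
  by (auto simp: adjacent_def children_def)

lemma adjacent_Nil_Cons:
  "adjacent (Some (Node ts)) [] (i # p) \<longleftrightarrow> i < length ts \<and> p = []"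
  by (auto simp: adjacent_def children_def)

lemma not_adjacent_refl: "\<not> adjacent T p p"
  by (auto simp: adjacent_def children_def)

lemma positions_snocD: "p @ [i] \<in> positions t \<Longrightarrow> p \<in> positions t"
  by (induction p arbitrary: t; case_tac t) auto

lemma mset_map_eq_permutation:
  assumes "mset (map f xs) = mset (map g ys)"
  obtains \<sigma> where "\<sigma> permutes {..<length xs}" "length ys = length xs"
    "\<And>i. i < length xs \<Longrightarrow> f (xs ! i) = g (ys ! \<sigma> i)"
proof -
  obtain \<sigma> where \<sigma>: "\<sigma> permutes {..<length (map g ys)}" "permute_list \<sigma> (map g ys) = map f xs"
    using mset_eq_permutation[OF assms] by blast
  have len: "length ys = length xs"
    using assms by (metis length_map size_mset)
  have "f (xs ! i) = g (ys ! \<sigma> i)" if "i < length xs" for i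
  proof -
    have "map f xs ! i = permute_list \<sigma> (map g ys) ! i" using \<sigma> by simp
    also have "\<dots> = map g ys ! \<sigma> i"
      using that len \<sigma>(1) by (subst permute_list_nth) auto
    also have "\<dots> = g (ys ! \<sigma> i)"
      using that len permutes_in_image[OF \<sigma>(1), of i] by simp
    finally show ?thesis using that by simp
  qed
  with \<sigma>(1) len that show thesis by simp
qed

text \<open>Equal multisets of types give a bijection \<open>\<sigma>\<close> between the branches
  that preserves types; the isomorphisms of matched branches are glued along it, and the root goes
  to the root.\<close>

lemma iso_if_canon_eq: "canon t = canon u \<Longrightarrow> iso (Some t) (Some u)"
proof (induction t arbitrary: u)
  case (Node ts)
  obtain us where u: "u = Node us" by (cases u)
  obtain \<sigma> where \<sigma>: "\<sigma> permutes {..<length ts}" and len: "length us = length ts"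
    and eq: "\<And>i. i < length ts \<Longrightarrow> canon (ts ! i) = canon (us ! \<sigma> i)"
    using Node.prems u mset_map_eq_permutation[of canon ts canon us] by auto
  have "\<forall>i. \<exists>f. i < length ts \<longrightarrow> bij_betw f (positions (ts ! i)) (positions (us ! \<sigma> i)) \<and>
      f [] = [] \<and>
      (\<forall>p\<in>positions (ts ! i). \<forall>q\<in>positions (ts ! i).
         adjacent (Some (ts ! i)) p q \<longleftrightarrow> adjacent (Some (us ! \<sigma> i)) (f p) (f q))"
    using Node.IH[OF nth_mem eq] by (auto simp: iso_def)
  then obtain F where F: "\<And>i. i < length ts \<Longrightarrow>
      bij_betw (F i) (positions (ts ! i)) (positions (us ! \<sigma> i))"
    "\<And>i. i < length ts \<Longrightarrow> F i [] = []"
    "\<And>i p q. i < length ts \<Longrightarrow> p \<in> positions (ts ! i) \<Longrightarrow> q \<in> positions (ts ! i) \<Longrightarrow>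
         adjacent (Some (ts ! i)) p q \<longleftrightarrow> adjacent (Some (us ! \<sigma> i)) (F i p) (F i q)"
    by metis
  have \<sigma>_less: "\<sigma> i < length ts \<longleftrightarrow> i < length ts" for i
    using permutes_in_image[OF \<sigma>, of i] by simp
  have \<sigma>_eq: "\<sigma> i = \<sigma> j \<longleftrightarrow> i = j" for i j
    using permutes_inj[OF \<sigma>] by (auto dest: injD)
  define f where "f = (\<lambda>p. case p of [] \<Rightarrow> [] | i # p' \<Rightarrow> \<sigma> i # F i p')"
  have f [simp]: "f [] = []" "f (i # p) = \<sigma> i # F i p" for i p
    by (simp_all add: f_def)
  have "inj_on f (positions (Node ts))"
  proof (rule inj_onI)
    fix p q assume "p \<in> positions (Node ts)" "q \<in> positions (Node ts)" "f p = f q"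
    then show "p = q"
      using F(1) by (cases p; cases q) (auto simp: \<sigma>_eq bij_betw_def dest: inj_onD)
  qed
  moreover have "f ` positions (Node ts) = positions (Node us)"
  proof (intro equalityI subsetI)
    fix q assume "q \<in> f ` positions (Node ts)"
    then obtain p where "p \<in> positions (Node ts)" "q = f p" by blast
    then show "q \<in> positions (Node us)"
      using F(1) len \<sigma>_less by (cases p) (auto simp: bij_betw_def)
  next
    fix q assume q: "q \<in> positions (Node us)"
    show "q \<in> f ` positions (Node ts)"
    proof (cases q)
      case Nil
      then show ?thesis by (auto simp: image_iff intro!: bexI[of _ "[]"])
    next
      case (Cons j q')
      then obtain i where i: "j = \<sigma> i" "i < length ts"
        using q len \<sigma>_less permutes_surj[OF \<sigma>] by (metis Cons_in_positions surjD)
      then obtain p' where "p' \<in> positions (ts ! i)" "q' = F i p'"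
        using q Cons F(1)[of i] by (auto simp: bij_betw_def)
      then show ?thesis
        using i Cons by (auto simp: image_iff intro!: bexI[of _ "i # p'"])
    qed
  qed
  moreover have "adjacent (Some (Node ts)) p q \<longleftrightarrow> adjacent (Some (Node us)) (f p) (f q)"
    if "p \<in> positions (Node ts)" "q \<in> positions (Node ts)" for p q
  proof -
    \<comment> \<open>The root is adjacent only to the roots of the branches, and by injectivity
      \<open>F i\<close> sends nothing but \<open>[]\<close> to \<open>[]\<close>.\<close>
    have *: "adjacent (Some (Node ts)) [] (i # r) \<longleftrightarrow> adjacent (Some (Node us)) [] (\<sigma> i # F i r)"
      if "i # r \<in> positions (Node ts)" for i r
    proof -
      have "F i r = [] \<longleftrightarrow> r = []"
        using that F(1)[of i] F(2)[of i] inj_onD[of "F i" "positions (ts ! i)" r "[]"]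
        by (auto simp: bij_betw_def)
      then show ?thesis
        using that len \<sigma>_less by (auto simp: adjacent_Nil_Cons)
    qed
    show ?thesis
    proof (cases p)
      case Nil
      then show ?thesis
        using * that by (cases q) (auto simp: not_adjacent_refl)
    next
      case p: (Cons i p')
      show ?thesis
      proof (cases q)
        case Nil
        then show ?thesis
          using * that p by (auto simp: adjacent_sym[of _ _ "[]"])
      next
        case q: (Cons j q')
        show ?thesis
        proof (cases "i = j")
          case True
          then show ?thesis
            using F(3)[of i p' q'] p q that len \<sigma>_less
            by (auto simp: adjacent_Cons)
        next
          case False
          then show ?thesis
            by (simp add: p q adjacent_Cons_neq \<sigma>_eq)
        qed
      qed
    qed
  qed
  ultimately show ?case
    unfolding iso_def u by (intro exI[of _ f]) (auto simp: bij_betw_def)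
qed

lemma image_mset_nth: "image_mset (\<lambda>i. f (xs ! i)) (mset_set {..<length xs}) = image_mset f (mset xs)"
proof -
  have "map f xs = map (\<lambda>i. f (xs ! i)) [0..<length xs]"
    by (rule nth_equalityI) auto
  then show ?thesis by (metis mset_map mset_upt atLeast0LessThan)
qed

text \<open>Adjacency is undirected, so an isomorphism must first be shown to send children to
  children; fixing the root forces this. It then respects depth and ancestry, hence maps each branch
  onto a branch, and induction applies to the restrictions.\<close>

lemma canon_eq_if_iso: "iso (Some t) (Some u) \<Longrightarrow> canon t = canon u"
proof (induction t arbitrary: u)
  case (Node ts)
  obtain us where u: "u = Node us" by (cases u)
  let ?t = "Node ts" and ?u = "Node us"
  obtain f where bij: "bij_betw f (positions ?t) (positions ?u)" and f_Nil: "f [] = []"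
    and adj: "\<And>p q. p \<in> positions ?t \<Longrightarrow> q \<in> positions ?t \<Longrightarrow>
      adjacent (Some ?t) p q \<longleftrightarrow> adjacent (Some ?u) (f p) (f q)"
    using Node.prems unfolding iso_def u by auto
  have inj: "f p = f q \<longleftrightarrow> p = q" if "p \<in> positions ?t" "q \<in> positions ?t" for p q
    using bij that by (auto simp: bij_betw_def dest: inj_onD)
  have in_u: "f p \<in> positions ?u" if "p \<in> positions ?t" for p
    using bij that bij_betwE by blast
  \<comment> \<open>The image of a child of \<open>p\<close> could otherwise only be the parent of \<open>f p\<close>, which is
    already the image of the parent of \<open>p\<close>.\<close>
  have child: "\<exists>k. f (p @ [j]) = f p @ [k]" if "p @ [j] \<in> positions ?t" for p j
    using that
  proof (induction p arbitrary: j rule: rev_induct)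
    case Nil
    then have "adjacent (Some ?u) (f []) (f [j])"
      by (subst adj[symmetric]) (auto simp: adjacent_Nil_Cons)
    then show ?case
      by (auto simp: adjacent_def children_def f_Nil)
  next
    case (snoc i p)
    note pj = snoc.prems
    have pi: "p @ [i] \<in> positions ?t" using pj positions_snocD by blast
    have p: "p \<in> positions ?t" using pi positions_snocD by blast
    obtain k where k: "f (p @ [i]) = f p @ [k]" using snoc.IH pi by blast
    have "adjacent (Some ?u) (f (p @ [i])) (f ((p @ [i]) @ [j]))"
      using pi pj by (subst adj[symmetric]) (auto simp: adjacent_def children_def)
    then have "(\<exists>l. f ((p @ [i]) @ [j]) = f (p @ [i]) @ [l]) \<or>
        (\<exists>l. f p @ [k] = f ((p @ [i]) @ [j]) @ [l])"
      using k by (auto simp: adjacent_def children_def)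
    moreover have "f p \<noteq> f ((p @ [i]) @ [j])"
      using inj[OF p pj] by simp
    ultimately show ?case by auto
  qed
  have len: "length (f p) = length p" if "p \<in> positions ?t" for p
    using that
  proof (induction p rule: rev_induct)
    case (snoc i p)
    then show ?case using child[of p i] positions_snocD by fastforce
  qed (simp add: f_Nil)
  have pre: "\<exists>r. f (p @ q) = f p @ r" if "p @ q \<in> positions ?t" for p q
    using that
  proof (induction q rule: rev_induct)
    case (snoc i q)
    then have "p @ q \<in> positions ?t"
      using positions_snocD[of "p @ q" i ?t] by simp
    then show ?case using snoc child[of "p @ q" i] by auto
  qed simp
  \<comment> \<open>\<open>\<sigma>\<close> is the map that \<open>f\<close> induces on the
    branches, and \<open>g i\<close> is the restriction of \<open>f\<close> to branch
    \<open>i\<close>, with values named relative to branch \<open>\<sigma> i\<close>.\<close>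
  define \<sigma> where "\<sigma> i = hd (f [i])" for i
  define g where "g i p = tl (f (i # p))" for i p
  have f_single: "f [i] = [\<sigma> i]" if "i < length ts" for i
    using len[of "[i]"] that unfolding \<sigma>_def by (cases "f [i]") auto
  have f_Cons: "f (i # p) = \<sigma> i # g i p" if "i # p \<in> positions ?t" for i p
  proof -
    have "i < length ts" using that by simp
    then show ?thesis
      using pre[of "[i]" p] that f_single by (auto simp: g_def)
  qed
  have \<sigma>_less: "\<sigma> i < length us" if "i < length ts" for i
    using in_u[of "[i]"] f_single[OF that] that by simp
  have \<sigma>_inj: "\<sigma> i = \<sigma> j \<longleftrightarrow> i = j" if "i < length ts" "j < length ts" for i j
    using inj[of "[i]" "[j]"] f_single that by simp
  have surj: "\<exists>i p. q = g i p \<and> j = \<sigma> i \<and> i # p \<in> positions ?t" if "j # q \<in> positions ?u" for j q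
  proof -
    obtain x where x: "x \<in> positions ?t" "f x = j # q"
      using bij \<open>j # q \<in> positions ?u\<close> unfolding bij_betw_def by (metis imageE)
    then obtain i p where "x = i # p" using f_Nil by (cases x) auto
    then show ?thesis using x f_Cons[of i p] by auto
  qed
  have canon_eq: "canon (ts ! i) = canon (us ! \<sigma> i)" if i: "i < length ts" for i
  proof (rule Node.IH)
    show "ts ! i \<in> set ts" using i by simp
    have "inj_on (g i) (positions (ts ! i))"
    proof (rule inj_onI)
      fix p q assume "p \<in> positions (ts ! i)" "q \<in> positions (ts ! i)" "g i p = g i q"
      then show "p = q"
        using inj[of "i # p" "i # q"] f_Cons[of i p] f_Cons[of i q] i by simp
    qed
    moreover have "g i ` positions (ts ! i) = positions (us ! \<sigma> i)"
    proof (intro equalityI subsetI)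
      fix q assume "q \<in> g i ` positions (ts ! i)"
      then obtain p where p: "p \<in> positions (ts ! i)" "q = g i p" by blast
      then show "q \<in> positions (us ! \<sigma> i)"
        using in_u[of "i # p"] f_Cons[of i p] i by simp
    next
      fix q assume "q \<in> positions (us ! \<sigma> i)"
      then have "\<sigma> i # q \<in> positions ?u" using \<sigma>_less[OF i] by simp
      then obtain i' p where "q = g i' p" "\<sigma> i = \<sigma> i'" "i' # p \<in> positions ?t"
        using surj by blast
      then show "q \<in> g i ` positions (ts ! i)" using \<sigma>_inj i by auto
    qed
    moreover have "g i [] = []" using f_single[OF i] by (simp add: g_def)
    moreover have "adjacent (Some (ts ! i)) p q \<longleftrightarrow> adjacent (Some (us ! \<sigma> i)) (g i p) (g i q)"
      if "p \<in> positions (ts ! i)" "q \<in> positions (ts ! i)" for p q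
      using adj[of "i # p" "i # q"] f_Cons[of i p] f_Cons[of i q] that i \<sigma>_less[OF i]
      by (simp add: adjacent_Cons)
    ultimately show "iso (Some (ts ! i)) (Some (us ! \<sigma> i))"
      unfolding iso_def by (intro exI[of _ "g i"]) (auto simp: bij_betw_def)
  qed
  have "bij_betw \<sigma> {..<length ts} {..<length us}"
    unfolding bij_betw_def
  proof (intro conjI equalityI subsetI)
    show "inj_on \<sigma> {..<length ts}" using \<sigma>_inj by (auto intro: inj_onI)
    fix j assume "j \<in> {..<length us}"
    then have "[j] \<in> positions ?u" by simp
    then show "j \<in> \<sigma> ` {..<length ts}" using surj by fastforce
  qed (use \<sigma>_less in auto)
  then have img: "image_mset \<sigma> (mset_set {..<length ts}) = mset_set {..<length us}"
    by (simp add: bij_betw_def image_mset_mset_set)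
  have mset_nth: "mset (map canon xs) = image_mset (\<lambda>i. canon (xs ! i)) (mset_set {..<length xs})"
    for xs :: "rtree list"
    by (simp add: image_mset_nth)
  have "mset (map canon ts) = image_mset (\<lambda>i. canon (us ! \<sigma> i)) (mset_set {..<length ts})"
    unfolding mset_nth using canon_eq by (intro image_mset_cong) auto
  also have "\<dots> = image_mset (\<lambda>j. canon (us ! j)) (image_mset \<sigma> (mset_set {..<length ts}))"
    by (simp add: image_mset.compositionality o_def)
  also have "\<dots> = mset (map canon us)"
    unfolding img mset_nth ..
  finally show ?case by (simp add: u)
qed

lemma iso_iff_canon: "iso T U \<longleftrightarrow> map_option canon T = map_option canon U"
proof (cases T; cases U)
  fix t u assume "T = Some t" "U = Some u"
  then show ?thesis using iso_if_canon_eq[of t u] canon_eq_if_iso[of t u] by auto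
next
  assume "T = None" "U = None"
  then show ?thesis unfolding iso_def by (auto simp: bij_betw_def intro: exI[of _ id])
next
  fix u assume "T = None" "U = Some u"
  then show ?thesis unfolding iso_def bij_betw_def using Nil_in_positions[of u] by (auto simp del: Nil_in_positions)
next
  fix t assume "T = Some t" "U = None"
  then show ?thesis unfolding iso_def bij_betw_def using Nil_in_positions[of t] by (auto simp del: Nil_in_positions)
qed

subsection \<open>Induced trees and the branch recursion\<close>

definition below :: "nat \<Rightarrow> nat list set \<Rightarrow> nat list set" where
  "below i S = {p. i # p \<in> S}"

definition occupied :: "rtree list \<Rightarrow> nat list set \<Rightarrow> nat set" where
  "occupied ts S = {i. i < length ts \<and> below i S \<noteq> {}}"

definition induced_type :: "rtree \<Rightarrow> nat list set \<Rightarrow> mtree option" where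
  "induced_type t S = map_option canon (induced (Some t) S)"

definition type_leaves :: "mtree option \<Rightarrow> nat" where
  "type_leaves m = (case m of None \<Rightarrow> 0 | Some m' \<Rightarrow> mleaves m')"

definition type_copies :: "mtree option \<Rightarrow> rtree \<Rightarrow> nat" where
  "type_copies m t = card {S. S \<subseteq> leaves (Some t) \<and> induced_type t S = m}"

text \<open>The padding by \<open>None\<close> stands for the empty branches, so that arrangements
  of this multiset are lists with one entry for each of the \<open>d\<close> branches.\<close>

definition branch_types :: "nat \<Rightarrow> mtree multiset \<Rightarrow> mtree option multiset" where
  "branch_types d X = image_mset Some X + replicate_mset (d - size X) None"

lemma below_empty [simp]: "below i {} = {}"
  by (simp add: below_def)

lemma in_below [simp]: "p \<in> below i S \<longleftrightarrow> i # p \<in> S"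
  by (simp add: below_def)

lemma below_image: "below i ((#) j ` S) = (if i = j then S else {})"
  by auto

lemma occupied_singletonD:
  assumes "occupied ts S = {i}"
  shows "i < length ts" "below i S \<noteq> {}"
proof -
  have "i \<in> occupied ts S" using assms by simp
  then show "i < length ts" "below i S \<noteq> {}" by (auto simp: occupied_def)
qed

lemma finite_occupied [simp]: "finite (occupied ts S)"
  by (simp add: occupied_def)

lemma below_subset_leaves: "S \<subseteq> leaves (Some (Node ts)) \<Longrightarrow> below i S \<subseteq> leaves (Some (ts ! i))"
  by auto

section \<open>Induced trees computed branch by branch\<close>

lemma suppress_Node:
  "suppress (Node ts) = (if length ts = 1 then suppress (hd ts) else Node (map suppress ts))"
proof (cases ts)
  case (Cons t us)
  then show ?thesis by (cases us) auto
qed simp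

lemma mset_sorted_list_of_set: "mset (sorted_list_of_set A) = mset_set A"
  by (metis sorted_list_of_mset_set mset_sorted_list_of_multiset)

lemma prune_Node:
  "prune (Node ts) S =
     Node (map (\<lambda>i. prune (ts ! i) (below i S)) (filter (\<lambda>i. below i S \<noteq> {}) [0..<length ts]))"
proof -
  have "(\<exists>p. i # p \<in> S) \<longleftrightarrow> below i S \<noteq> {}" for i by auto
  then show ?thesis by (simp add: below_def[symmetric])
qed

declare prune.simps [simp del]

lemma filter_occupied:
  "filter (\<lambda>i. below i S \<noteq> {}) [0..<length ts] = sorted_list_of_set (occupied ts S)"
  unfolding occupied_def
  by (rule sorted_distinct_set_unique) (auto intro: sorted_wrt_filter)

lemma suppress_prune_single:
  assumes "occupied ts S = {i}"
  shows "suppress (prune (Node ts) S) = suppress (prune (ts ! i) (below i S))"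
  using assms by (simp add: prune_Node filter_occupied)

lemma suppress_prune_multiple:
  assumes "card (occupied ts S) \<noteq> 1"
  shows "suppress (prune (Node ts) S) =
    Node (map (\<lambda>i. suppress (prune (ts ! i) (below i S))) (sorted_list_of_set (occupied ts S)))"
  using assms by (simp add: prune_Node filter_occupied suppress_Node)

lemma UN_below:
  assumes "S \<subseteq> leaves (Some (Node ts))" "ts \<noteq> []"
  shows "(\<Union>i<length ts. (#) i ` below i S) = S"
proof (intro equalityI subsetI)
  fix p assume "p \<in> S"
  moreover from this have "p \<in> leaves (Some (Node ts))" using assms(1) by blast
  ultimately show "p \<in> (\<Union>i<length ts. (#) i ` below i S)"
    using assms(2) by (cases p) (auto simp: Nil_in_leaves image_iff)
qed auto

lemma image_below_eq:
  assumes "S \<subseteq> leaves (Some (Node ts))" "occupied ts S = {i}"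
  shows "(#) i ` below i S = S"
proof -
  have "ts \<noteq> []" using occupied_singletonD(1)[OF assms(2)] by auto
  have "(\<Union>j\<in>occupied ts S. (#) j ` below j S) = (\<Union>j<length ts. (#) j ` below j S)"
    by (auto simp: occupied_def)
  also have "\<dots> = S" using UN_below[OF assms(1) \<open>ts \<noteq> []\<close>] .
  finally show ?thesis using assms(2) by simp
qed

text \<open>Pruning from the root leaves a chain of vertices with one child above the most recent
  common ancestor, and suppression removes this chain.\<close>

lemma induced_eq:
  assumes "S \<subseteq> leaves (Some t)" "S \<noteq> {}"
  shows "induced (Some t) S = Some (suppress (prune t S))"
  using assms
proof (induction t arbitrary: S)
  case (Node ts)
  show ?case
  proof (cases "card (occupied ts S) = 1")
    case True
    then obtain i where i: "occupied ts S = {i}" by (auto simp: card_1_singleton_iff)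
    let ?S = "below i S"
    have S: "(#) i ` ?S = S" using image_below_eq[OF Node.prems(1) i] .
    have ne: "?S \<noteq> {}" and i_less: "i < length ts" using occupied_singletonD[OF i] by simp_all
    have "Longest_common_prefix S = i # Longest_common_prefix ?S"
      using Longest_common_prefix_image_Cons[OF ne, of i] S by simp
    then have "induced (Some (Node ts)) S = induced (Some (ts ! i)) ?S"
      using Node.prems(2) ne by (simp add: Let_def)
    also have "\<dots> = Some (suppress (prune (ts ! i) ?S))"
      using Node.IH[of "ts ! i" ?S] i_less ne below_subset_leaves[OF Node.prems(1)] by simp
    finally show ?thesis using i by (simp add: suppress_prune_single)
  next
    case False
    \<comment> \<open>Either the tree is a single leaf and \<open>S\<close> is \<open>{[]}\<close>,
      or two branches are occupied and paths in \<open>S\<close> differ in their first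
      entry.\<close>
    have "Longest_common_prefix S = []"
    proof (cases "[] \<in> S")
      case True
      then show ?thesis by (rule Longest_common_prefix_Nil)
    next
      case Nil: False
      obtain i p where ip: "i # p \<in> S" using Node.prems(2) Nil by (metis ex_in_conv list.exhaust)
      then have i: "i \<in> occupied ts S" using Node.prems(1) by (auto simp: occupied_def)
      have "occupied ts S \<noteq> {i}" using False by auto
      then obtain j q where "j # q \<in> S" "j \<noteq> i" using i by (auto simp: occupied_def)
      then show ?thesis using ip Longest_common_prefix_eq_Nil by metis
    qed
    then show ?thesis using Node.prems(2) by simp
  qed
qed

declare induced.simps(2) [simp del]

lemma induced_type_empty [simp]: "induced_type t {} = None"
  by (simp add: induced_type_def induced.simps)

lemma induced_type_eq:
  "S \<subseteq> leaves (Some t) \<Longrightarrow> S \<noteq> {} \<Longrightarrow> induced_type t S = Some (canon (suppress (prune t S)))"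
  by (simp add: induced_type_def induced_eq)

lemma induced_type_None_iff:
  "S \<subseteq> leaves (Some t) \<Longrightarrow> induced_type t S = None \<longleftrightarrow> S = {}"
  by (cases "S = {}") (simp_all add: induced_type_eq)

lemma induced_type_single:
  assumes "S \<subseteq> leaves (Some (Node ts))" "occupied ts S = {i}"
  shows "induced_type (Node ts) S = induced_type (ts ! i) (below i S)"
proof -
  have "below i S \<noteq> {}" using occupied_singletonD(2)[OF assms(2)] .
  moreover from this have "S \<noteq> {}" by auto
  ultimately show ?thesis
    using assms below_subset_leaves[OF assms(1)] by (simp add: induced_type_eq suppress_prune_single)
qed

text \<open>After pruning, the root has one child for each occupied branch, so that it survives
  suppression.\<close>

lemma induced_type_multiple:
  assumes "S \<subseteq> leaves (Some (Node ts))" "S \<noteq> {}" "card (occupied ts S) \<noteq> 1"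
  shows "induced_type (Node ts) S =
    Some (MNode (image_mset (\<lambda>i. the (induced_type (ts ! i) (below i S))) (mset_set (occupied ts S))))"
proof -
  have "induced_type (ts ! i) (below i S) = Some (canon (suppress (prune (ts ! i) (below i S))))"
    if "i \<in> occupied ts S" for i
    using that below_subset_leaves[OF assms(1)] by (intro induced_type_eq) (auto simp: occupied_def)
  then have "image_mset (\<lambda>i. the (induced_type (ts ! i) (below i S))) (mset_set (occupied ts S))
      = image_mset (\<lambda>i. canon (suppress (prune (ts ! i) (below i S)))) (mset_set (occupied ts S))"
    by (intro image_mset_cong) simp
  then show ?thesis
    using assms by (simp add: induced_type_eq suppress_prune_multiple o_def mset_sorted_list_of_set)
qed

lemma card_eq_sum_below:
  assumes "S \<subseteq> leaves (Some (Node ts))" "ts \<noteq> []"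
  shows "card S = (\<Sum>i<length ts. card (below i S))"
proof -
  have "finite (below i S)" for i
    using finite_subset[OF below_subset_leaves[OF assms(1)]] by simp
  then have "card (\<Union>i<length ts. (#) i ` below i S) = (\<Sum>i<length ts. card ((#) i ` below i S))"
    by (intro card_UN_disjoint) auto
  then show ?thesis using UN_below[OF assms] by (simp add: card_image)
qed

text \<open>Pruning keeps the members of \<open>S\<close> as the only leaves, and suppression
  removes only vertices that have a child.\<close>

lemma type_leaves_induced_type:
  "S \<subseteq> leaves (Some t) \<Longrightarrow> type_leaves (induced_type t S) = card S"
proof (induction t arbitrary: S)
  case (Node ts)
  note IH = Node.IH[OF nth_mem below_subset_leaves[OF Node.prems]]
  have sum: "card S = (\<Sum>i\<in>occupied ts S. card (below i S))" if "ts \<noteq> []"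
    unfolding card_eq_sum_below[OF Node.prems that]
    by (rule sum.mono_neutral_right) (auto simp: occupied_def)
  show ?case
  proof (cases "S = {}")
    case False
    show ?thesis
    proof (cases "card (occupied ts S) = 1")
      case True
      then obtain i where i: "occupied ts S = {i}" by (auto simp: card_1_singleton_iff)
      then have "i < length ts" "ts \<noteq> []" using occupied_singletonD(1)[OF i] by auto
      then show ?thesis using sum i IH by (simp add: induced_type_single[OF Node.prems])
    next
      case many: False
      note eq = induced_type_multiple[OF Node.prems False many]
      show ?thesis
      proof (cases "ts = []")
        case True
        then have "S = {[]}" using False Node.prems by (auto simp: leaves_Node)
        then show ?thesis using True eq by (simp add: occupied_def type_leaves_def)
      next
        case ne: False
        \<comment> \<open>This rules out the clause of \<open>mleaves\<close> for the empty
          multiset, which would count one leaf.\<close>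
        have "occupied ts S \<noteq> {}"
          using sum[OF ne] False finite_subset[OF Node.prems] by auto
        moreover have card: "mleaves (the (induced_type (ts ! i) (below i S))) = card (below i S)"
          if "i \<in> occupied ts S" for i
        proof -
          have "i < length ts" "below i S \<noteq> {}" using that by (auto simp: occupied_def)
          then have "induced_type (ts ! i) (below i S) \<noteq> None"
            using induced_type_None_iff[OF below_subset_leaves[OF Node.prems]] by blast
          then show ?thesis using IH[OF \<open>i < length ts\<close>] by (auto simp: type_leaves_def)
        qed
        moreover have "(\<Sum>i\<in>occupied ts S. mleaves (the (induced_type (ts ! i) (below i S))))
            = card S"
          unfolding sum[OF ne] by (rule sum.cong[OF refl card])
        ultimately show ?thesis
          unfolding eq
          by (simp add: type_leaves_def mset_set_empty_iff image_mset.compositionality o_def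
              flip: sum_unfold_sum_mset)
      qed
    qed
  qed (simp add: type_leaves_def)
qed

lemma type_leaves_canon: "type_leaves (map_option canon D) = nleaves D"
proof (cases D)
  case None
  then show ?thesis by (simp add: type_leaves_def nleaves_def leaves_def)
next
  case (Some t)
  then show ?thesis by (simp add: type_leaves_def mleaves_canon)
qed

text \<open>An induced type has as many leaves as the set that induces it, so that both counts range
  over the same sets.\<close>

lemma copies_eq_type_copies: "copies D (Some t) = type_copies (map_option canon D) t"
proof -
  have "S \<subseteq> leaves (Some t) \<and> card S = nleaves D \<and> iso (induced (Some t) S) D \<longleftrightarrow>
      S \<subseteq> leaves (Some t) \<and> induced_type t S = map_option canon D" for S
    by (metis iso_iff_canon induced_type_def type_leaves_induced_type type_leaves_canon)
  then show ?thesis by (simp add: copies_def type_copies_def)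
qed

lemma type_copies_None: "type_copies None t = 1"
proof -
  have "{S. S \<subseteq> leaves (Some t) \<and> induced_type t S = None} = {{}}"
    using induced_type_None_iff[of _ t] by (auto simp del: Cons_in_leaves)
  then show ?thesis by (simp add: type_copies_def)
qed

section \<open>Types determined by their number of leaves\<close>

lemma no_unary_suppress: "no_unary (canon (suppress t))"
  by (induction t rule: suppress.induct) auto

lemma mleaves_pos: "0 < mleaves m"
proof (induction m)
  case (MNode X)
  then show ?case by (cases X) auto
qed

lemma size_le_sum_mleaves: "size X \<le> sum_mset (image_mset mleaves X)"
proof (induction X)
  case (add x X)
  then show ?case using mleaves_pos[of x] by simp
qed simp

lemma mleaves_eq_1:
  assumes "no_unary m" "mleaves m = 1"
  shows "m = MNode {#}"
proof (cases m)
  case (MNode X)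
  have "X = {#}"
  proof (rule ccontr)
    assume X: "X \<noteq> {#}"
    then have "size X \<le> 1" using assms(2) MNode size_le_sum_mleaves[of X] by simp
    moreover have "size X \<noteq> 0" "size X \<noteq> 1" using X assms(1) MNode by simp_all
    ultimately show False by linarith
  qed
  then show ?thesis using MNode by simp
qed

text \<open>Every child has a leaf and a single child is forbidden, so two leaves force two children
  with one leaf each.\<close>

lemma mleaves_eq_2:
  assumes "no_unary m" "mleaves m = 2"
  shows "m = MNode {#MNode {#}, MNode {#}#}"
proof (cases m)
  case (MNode X)
  have "X \<noteq> {#}" using assms MNode by auto
  then have "size X \<noteq> 0" "size X \<noteq> 1" "size X \<le> 2"
    using assms MNode size_le_sum_mleaves[of X] by simp_all
  then have "size X = Suc 1" by linarith
  then obtain x Y where "X = add_mset x Y" using size_eq_Suc_imp_eq_union by blast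
  moreover from this obtain y where "Y = {#y#}"
    using \<open>size X = Suc 1\<close> size_1_singleton_mset[of Y] by auto
  ultimately have X: "X = {#x, y#}" by simp
  have "mleaves x = 1" "mleaves y = 1"
    using assms MNode X mleaves_pos[of x] mleaves_pos[of y] by auto
  then show ?thesis using assms MNode X mleaves_eq_1[of x] mleaves_eq_1[of y] by simp
qed

text \<open>Suppressed trees have no vertex with one child. If \<open>m\<close> is the only such
  type with its number of leaves, every leaf set of that size induces it.\<close>

lemma type_copies_eq_choose:
  assumes "\<And>m'. no_unary m' \<Longrightarrow> mleaves m' = mleaves m \<Longrightarrow> m' = m"
  shows "type_copies (Some m) t = (nleaves (Some t) choose mleaves m)"
proof -
  have "induced_type t S = Some m \<longleftrightarrow> card S = mleaves m" if S: "S \<subseteq> leaves (Some t)" for S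
  proof
    assume "induced_type t S = Some m"
    then show "card S = mleaves m"
      using type_leaves_induced_type[OF S] by (simp add: type_leaves_def)
  next
    assume *: "card S = mleaves m"
    then have "S \<noteq> {}" using mleaves_pos[of m] by auto
    then have eq: "induced_type t S = Some (canon (suppress (prune t S)))"
      by (rule induced_type_eq[OF S])
    then have "mleaves (canon (suppress (prune t S))) = mleaves m"
      using type_leaves_induced_type[OF S] * by (simp add: type_leaves_def)
    then show "induced_type t S = Some m"
      using assms no_unary_suppress eq by simp
  qed
  then have "type_copies (Some m) t = card {S. S \<subseteq> leaves (Some t) \<and> card S = mleaves m}"
    unfolding type_copies_def by (intro arg_cong[of _ _ card]) auto
  then show ?thesis by (simp add: n_subsets nleaves_def)
qed

lemma type_copies_leaf: "type_copies (Some (MNode {#})) t = nleaves (Some t)"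
  using type_copies_eq_choose[of "MNode {#}" t] mleaves_eq_1 by simp

lemma type_copies_cherry:
  "type_copies (Some (MNode {#MNode {#}, MNode {#}#})) t = (nleaves (Some t) choose 2)"
  using type_copies_eq_choose[of "MNode {#MNode {#}, MNode {#}#}" t] mleaves_eq_2
  by (simp add: numeral_2_eq_2)

lemma type_copies_Leaf:
  assumes "X \<noteq> {#}"
  shows "type_copies (Some (MNode X)) Leaf = 0"
proof -
  have "induced_type Leaf S \<noteq> Some (MNode X)" if "S \<subseteq> leaves (Some Leaf)" for S
  proof -
    have "S = {} \<or> S = {[]}" using that by (auto simp: leaves_Node)
    then show ?thesis
      using assms induced_type_multiple[of "{[]}" "[]"]
      by (auto simp: occupied_def leaves_Node)
  qed
  then have "{S. S \<subseteq> leaves (Some Leaf) \<and> induced_type Leaf S = Some (MNode X)} = {}" by blast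
  then show ?thesis by (simp add: type_copies_def)
qed

section \<open>Splitting the counts over the branches\<close>

lemma padded_eq_iff:
  "image_mset Some Y + replicate_mset a None = image_mset Some X + replicate_mset b None
     \<longleftrightarrow> Y = X \<and> a = b" (is "?l = ?r \<longleftrightarrow> _")
proof
  assume eq: "?l = ?r"
  have "image_mset the (filter_mset (\<lambda>x. x \<noteq> None) (image_mset Some Z + replicate_mset c None)) = Z"
    for Z :: "'a multiset" and c
    by (simp add: image_mset.compositionality o_def filter_mset_image_mset)
  with eq have "Y = X" by metis
  with eq show "Y = X \<and> a = b" by (auto dest: arg_cong[of _ _ size])
qed simp

text \<open>Branches that \<open>S\<close> misses have induced type \<open>None\<close>; they are
  exactly the padding.\<close>

lemma mset_branch_types:
  assumes "S \<subseteq> leaves (Some (Node ts))"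
  shows "mset (map (\<lambda>i. induced_type (ts ! i) (below i S)) [0..<length ts]) =
    image_mset Some (image_mset (\<lambda>i. the (induced_type (ts ! i) (below i S))) (mset_set (occupied ts S)))
    + replicate_mset (length ts - card (occupied ts S)) None"
proof -
  let ?I = "occupied ts S" and ?f = "\<lambda>i. induced_type (ts ! i) (below i S)"
  have sub: "?I \<subseteq> {..<length ts}" by (auto simp: occupied_def)
  have None_iff: "?f i = None \<longleftrightarrow> below i S = {}" for i
    by (rule induced_type_None_iff[OF below_subset_leaves[OF assms]])
  have "mset_set (?I \<union> ({..<length ts} - ?I)) = mset_set ?I + mset_set ({..<length ts} - ?I)"
    by (rule mset_set_Union) auto
  moreover have "?I \<union> ({..<length ts} - ?I) = {..<length ts}" using sub by blast
  ultimately have "mset (map ?f [0..<length ts]) =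
      image_mset ?f (mset_set ?I) + image_mset ?f (mset_set ({..<length ts} - ?I))"
    by (simp add: atLeast0LessThan)
  also have "image_mset ?f (mset_set ?I) = image_mset (\<lambda>i. Some (the (?f i))) (mset_set ?I)"
    by (intro image_mset_cong) (use None_iff in \<open>auto simp: occupied_def\<close>)
  also have "image_mset ?f (mset_set ({..<length ts} - ?I)) =
      image_mset (\<lambda>i. None) (mset_set ({..<length ts} - ?I))"
    by (intro image_mset_cong) (use None_iff in \<open>auto simp: occupied_def\<close>)
  also have "\<dots> = replicate_mset (length ts - card ?I) None"
    using sub by (simp add: image_mset_const_eq card_Diff_subset)
  finally show ?thesis by (simp add: image_mset.compositionality o_def)
qed

text \<open>The number of occupied branches decides whether the root survives suppression. The
  second claim makes the alternatives exclusive: an arrangement of \<open>branch_types\<close> has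
  \<open>size X\<close>, hence at least two, entries other than \<open>None\<close>.\<close>

lemma induced_type_eq_MNode_iff:
  assumes S: "S \<subseteq> leaves (Some (Node ts))" and X: "2 \<le> size X" "size X \<le> length ts"
  defines "hs \<equiv> map (\<lambda>i. induced_type (ts ! i) (below i S)) [0..<length ts]"
  shows "induced_type (Node ts) S = Some (MNode X) \<longleftrightarrow>
    (if card (occupied ts S) = 1
     then \<exists>i<length ts. \<exists>S'\<subseteq>leaves (Some (ts ! i)). S = (#) i ` S' \<and> induced_type (ts ! i) S' = Some (MNode X)
     else mset hs = branch_types (length ts) X)"
    (is "_ \<longleftrightarrow> (if _ then ?one else ?many)")
  and "mset hs = branch_types (length ts) X \<Longrightarrow> card (occupied ts S) \<noteq> 1"
proof -
  let ?Y = "image_mset (\<lambda>i. the (induced_type (ts ! i) (below i S))) (mset_set (occupied ts S))"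
  have many_iff: "?many \<longleftrightarrow> ?Y = X"
    unfolding hs_def mset_branch_types[OF S] branch_types_def padded_eq_iff by auto
  show "mset hs = branch_types (length ts) X \<Longrightarrow> card (occupied ts S) \<noteq> 1"
    using many_iff X by auto
  show "induced_type (Node ts) S = Some (MNode X) \<longleftrightarrow>
    (if card (occupied ts S) = 1 then ?one else ?many)"
  proof (cases "card (occupied ts S) = 1")
    case True
    then obtain i where i: "occupied ts S = {i}" by (auto simp: card_1_singleton_iff)
    then have "i < length ts" using occupied_singletonD(1) by blast
    have "?one \<longleftrightarrow> induced_type (ts ! i) (below i S) = Some (MNode X)"
    proof
      assume ?one
      then obtain j S' where j: "j < length ts" "S = (#) j ` S'" "induced_type (ts ! j) S' = Some (MNode X)"
        by blast
      then have "S' \<noteq> {}" by auto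
      then have "j \<in> occupied ts S" using j by (simp add: occupied_def below_image)
      then have "j = i" using i by simp
      then show "induced_type (ts ! i) (below i S) = Some (MNode X)"
        using j by (simp add: below_image)
    next
      assume "induced_type (ts ! i) (below i S) = Some (MNode X)"
      then show ?one
        using \<open>i < length ts\<close> image_below_eq[OF S i, symmetric] below_subset_leaves[OF S, of i]
        by blast
    qed
    then show ?thesis using True induced_type_single[OF S i] by simp
  next
    case False
    show ?thesis
    proof (cases "S = {}")
      case True
      then have "?Y = {#}" by (simp add: occupied_def)
      then show ?thesis using True False X many_iff by auto
    next
      case ne: False
      show ?thesis using False many_iff induced_type_multiple[OF S ne False] by simp
    qed
  qed
qed

text \<open>A leaf set amounts to an independent choice of its part in each branch, so the count
  factors.\<close>

lemma card_leaf_sets_with_types: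
  assumes "length hs = length ts" "ts \<noteq> []"
  shows "card {S. S \<subseteq> leaves (Some (Node ts)) \<and>
           map (\<lambda>i. induced_type (ts ! i) (below i S)) [0..<length ts] = hs}
       = (\<Prod>i<length ts. type_copies (hs ! i) (ts ! i))"
proof -
  let ?A = "{S. S \<subseteq> leaves (Some (Node ts)) \<and>
      map (\<lambda>i. induced_type (ts ! i) (below i S)) [0..<length ts] = hs}"
  let ?B = "\<lambda>i. {S. S \<subseteq> leaves (Some (ts ! i)) \<and> induced_type (ts ! i) S = hs ! i}"
  have hs_iff: "map (\<lambda>i. induced_type (ts ! i) (below i S)) [0..<length ts] = hs \<longleftrightarrow>
      (\<forall>i<length ts. induced_type (ts ! i) (below i S) = hs ! i)" for S
    by (simp only: list_eq_iff_nth_eq assms(1) length_map length_upt diff_zero) simp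
  have below_Un: "below i (\<Union>j<length ts. (#) j ` g j) = g i" if "i < length ts" for i g
    using that by (simp add: below_def image_iff)
  have "bij_betw (\<lambda>S. \<lambda>i\<in>{..<length ts}. below i S) ?A (PiE {..<length ts} ?B)"
  proof (rule bij_betwI[where g = "\<lambda>g. \<Union>i<length ts. (#) i ` g i"])
    show "(\<lambda>S. \<lambda>i\<in>{..<length ts}. below i S) \<in> ?A \<rightarrow> PiE {..<length ts} ?B"
      using below_subset_leaves by (intro funcsetI PiE_I) (simp_all add: hs_iff)
    show "(\<lambda>g. \<Union>i<length ts. (#) i ` g i) \<in> PiE {..<length ts} ?B \<rightarrow> ?A"
    proof
      fix g assume g: "g \<in> PiE {..<length ts} ?B"
      then have "(\<Union>i<length ts. (#) i ` g i) \<subseteq> leaves (Some (Node ts))"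
        by (fastforce simp: PiE_def Pi_def)
      then show "(\<Union>i<length ts. (#) i ` g i) \<in> ?A"
        using g by (simp add: hs_iff below_Un PiE_def Pi_def)
    qed
    fix S assume "S \<in> ?A"
    then have "S \<subseteq> leaves (Some (Node ts))" by simp
    from UN_below[OF this assms(2)]
    show "(\<Union>i<length ts. (#) i ` (\<lambda>i\<in>{..<length ts}. below i S) i) = S" by simp
  next
    fix g assume "g \<in> PiE {..<length ts} ?B"
    then show "(\<lambda>i\<in>{..<length ts}. below i (\<Union>i<length ts. (#) i ` g i)) = g"
      by (intro ext) (auto simp: below_Un PiE_def extensional_def restrict_def)
  qed
  then have "card ?A = card (PiE {..<length ts} ?B)" by (rule bij_betw_same_card)
  then show ?thesis by (simp add: card_PiE type_copies_def)
qed

text \<open>\<open>?U\<close> collects the sets inside one branch, \<open>?V\<close> the sets spread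
  over several. The list of types that a set induces in the branches splits \<open>?V\<close> into
  disjoint classes, each of which is counted by a product.\<close>

lemma type_copies_Node:
  assumes X: "2 \<le> size X" "size X \<le> length ts"
  shows "type_copies (Some (MNode X)) (Node ts) =
    (\<Sum>i<length ts. type_copies (Some (MNode X)) (ts ! i)) +
    (\<Sum>hs\<in>permutations_of_multiset (branch_types (length ts) X).
       \<Prod>i<length ts. type_copies (hs ! i) (ts ! i))"
proof -
  let ?P = "permutations_of_multiset (branch_types (length ts) X)"
  let ?hs = "\<lambda>S. map (\<lambda>i. induced_type (ts ! i) (below i S)) [0..<length ts]"
  let ?L = "leaves (Some (Node ts))"
  let ?A = "\<lambda>i. {S. S \<subseteq> leaves (Some (ts ! i)) \<and> induced_type (ts ! i) S = Some (MNode X)}"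
  let ?U = "\<Union>i<length ts. (`) ((#) i) ` ?A i"
  let ?V = "\<Union>hs\<in>?P. {S. S \<subseteq> ?L \<and> ?hs S = hs}"
  have "ts \<noteq> []" using X by auto
  have U_sub: "S \<subseteq> ?L" and U_card: "card (occupied ts S) = 1" if S_in: "S \<in> ?U" for S
  proof -
    obtain i S' where S: "i < length ts" "S = (#) i ` S'" "S' \<subseteq> leaves (Some (ts ! i))"
        "induced_type (ts ! i) S' = Some (MNode X)"
      using S_in by blast
    then show "S \<subseteq> ?L" by auto
    have "S' \<noteq> {}" using S by auto
    then have "occupied ts S = {i}" using S by (auto simp: occupied_def below_image)
    then show "card (occupied ts S) = 1" by simp
  qed
  have V_card: "card (occupied ts S) \<noteq> 1" if "S \<in> ?V" for S
  proof -
    have "S \<subseteq> ?L" "mset (?hs S) = branch_types (length ts) X"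
      using that by (auto dest: permutations_of_multisetD)
    then show ?thesis by (rule induced_type_eq_MNode_iff(2)[OF _ X])
  qed
  have "{S. S \<subseteq> ?L \<and> induced_type (Node ts) S = Some (MNode X)} = ?U \<union> ?V"
  proof (intro set_eqI)
    fix S
    show "S \<in> {S. S \<subseteq> ?L \<and> induced_type (Node ts) S = Some (MNode X)} \<longleftrightarrow> S \<in> ?U \<union> ?V"
    proof (cases "S \<subseteq> ?L")
      case True
      have "S \<in> ?U \<longleftrightarrow> (\<exists>i<length ts. \<exists>S'\<subseteq>leaves (Some (ts ! i)).
          S = (#) i ` S' \<and> induced_type (ts ! i) S' = Some (MNode X))" by blast
      moreover have "S \<in> ?V \<longleftrightarrow> mset (?hs S) = branch_types (length ts) X"
        using True by (auto simp: permutations_of_multiset_def)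
      ultimately show ?thesis
        using induced_type_eq_MNode_iff(1)[OF True X] U_card[of S] V_card[of S] True by auto
    next
      case False
      then show ?thesis using U_sub by blast
    qed
  qed
  moreover have "finite ?U"
    by (rule finite_subset[of _ "Pow ?L"]) (use U_sub in auto)
  moreover have "finite ?V"
    by (rule finite_subset[of _ "Pow ?L"]) auto
  moreover have "?U \<inter> ?V = {}" using U_card V_card by blast
  ultimately have "type_copies (Some (MNode X)) (Node ts) = card ?U + card ?V"
    by (simp add: type_copies_def card_Un_disjoint)
  also have "card ?U = (\<Sum>i<length ts. card ((`) ((#) i) ` ?A i))"
  proof (rule card_UN_disjoint)
    show "\<forall>i\<in>{..<length ts}. finite ((`) ((#) i) ` ?A i)"
      by (auto intro: finite_subset[of _ "Pow (leaves (Some _))"])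
    show "\<forall>i\<in>{..<length ts}. \<forall>j\<in>{..<length ts}. i \<noteq> j \<longrightarrow>
        (`) ((#) i) ` ?A i \<inter> (`) ((#) j) ` ?A j = {}"
    proof (intro ballI impI equals0I)
      fix i j S assume "i \<noteq> j" and S: "S \<in> (`) ((#) i) ` ?A i \<inter> (`) ((#) j) ` ?A j"
      then obtain S1 S2 where S12: "(#) i ` S1 = (#) j ` S2" "S1 \<in> ?A i" by blast
      \<comment> \<open>The empty set has the same image under every \<open>(#) i\<close>, but its
        type is \<open>None\<close>.\<close>
      then have "S1 \<noteq> {}" by auto
      then obtain p where "p \<in> S1" by blast
      then have "i # p \<in> (#) j ` S2" using S12(1) by blast
      with \<open>i \<noteq> j\<close> show False by blast
    qed
  qed simp
  also have "\<dots> = (\<Sum>i<length ts. type_copies (Some (MNode X)) (ts ! i))"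
  proof (rule sum.cong)
    fix i
    have "inj_on ((`) ((#) i)) (?A i)"
      by (intro inj_onI) (simp add: inj_image_eq_iff)
    then show "card ((`) ((#) i) ` ?A i) = type_copies (Some (MNode X)) (ts ! i)"
      by (simp add: card_image type_copies_def)
  qed simp
  also have "card ?V = (\<Sum>hs\<in>?P. card {S. S \<subseteq> ?L \<and> ?hs S = hs})"
    by (rule card_UN_disjoint) auto
  also have "\<dots> = (\<Sum>hs\<in>?P. \<Prod>i<length ts. type_copies (hs ! i) (ts ! i))"
  proof (rule sum.cong)
    fix hs assume "hs \<in> ?P"
    then have "mset hs = branch_types (length ts) X" by (rule permutations_of_multisetD)
    then have "size (mset hs) = length ts" using X by (simp add: branch_types_def)
    then show "card {S. S \<subseteq> ?L \<and> ?hs S = hs} = (\<Prod>i<length ts. type_copies (hs ! i) (ts ! i))"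
      by (intro card_leaf_sets_with_types) (simp_all add: \<open>ts \<noteq> []\<close>)
  qed simp
  finally show ?thesis .
qed

subsection \<open>Leaves and children of the strictly d-ary trees\<close>

declare H.simps(2) [simp del]

text \<open>For \<open>n > 0\<close> this is the index of branch \<open>i\<close> of
  \<open>H d n\<close>: with n - 1 = ds + b it is s for the first d - b branches and s + 1 for the
  others.\<close>

definition child_index :: "nat \<Rightarrow> nat \<Rightarrow> nat \<Rightarrow> nat" where
  "child_index d i n = (n - 1) div d + (if i < d - (n - 1) mod d then 0 else 1)"

lemma H_eq_Node:
  assumes "0 < d" "0 < n"
  shows "H d n = Node (map (\<lambda>i. H d (child_index d i n)) [0..<d])"
proof -
  obtain m where n: "n = Suc m" using assms(2) gr0_implies_Suc by blast
  have "m mod d < d" using assms(1) by simp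
  then show ?thesis
    unfolding n H.simps(2)[of d m, unfolded Let_def]
    by (auto intro!: nth_equalityI simp: nth_append child_index_def)
qed

lemma sum_child_index:
  assumes "0 < d"
  shows "(\<Sum>i<d. child_index d i n) = n - 1"
proof -
  have "(\<Sum>i<d. if i < d - (n - 1) mod d then 0 else 1) = card {i\<in>{..<d}. \<not> i < d - (n - 1) mod d}"
    by (simp add: sum.If_cases Collect_conj_eq[symmetric] Int_def)
  also have "{i\<in>{..<d}. \<not> i < d - (n - 1) mod d} = {d - (n - 1) mod d..<d}" by auto
  finally show ?thesis
    using mod_less_divisor[OF assms, of "n - 1"] by (simp add: child_index_def sum.distrib)
qed

text \<open>Serves twice: the strong inductions on \<open>n\<close> descend by it, and the factor 2
  is the gain in the error estimate of the recurrence.\<close>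

lemma two_child_index_le:
  assumes "2 \<le> d" "i < d" "0 < n"
  shows "2 * child_index d i n \<le> n"
proof -
  define s b where "s = (n - 1) div d" and "b = (n - 1) mod d"
  have "2 * s \<le> d * s" using assms(1) by simp
  moreover have "d * s + b = n - 1" by (simp add: s_def b_def)
  ultimately have *: "2 * s + b + 1 \<le> n" using assms(3) by linarith
  show ?thesis
  proof (cases "i < d - b")
    case True
    then have "child_index d i n = s" by (simp add: child_index_def s_def b_def)
    then show ?thesis using * by linarith
  next
    case False
    then have "child_index d i n = s + 1" by (simp add: child_index_def s_def b_def)
    \<comment> \<open>The index \<open>s + 1\<close> occurs only for positive \<open>b\<close>,
      which supplies the missing unit in \<open>2 * s + 2 \<le> n\<close>.\<close>
    moreover have "b \<noteq> 0" using False assms(2) by (metis diff_zero)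
    ultimately show ?thesis using * by linarith
  qed
qed

text \<open>Both numbers lie between \<open>s\<close> and \<open>s + 1\<close>, so the bound 2 is
  generous.\<close>

lemma child_index_bounds:
  assumes "0 < d" "0 < n"
  shows "\<bar>real (child_index d i n) - real n / real d\<bar> \<le> 2"
proof -
  define s b where "s = (n - 1) div d" and "b = (n - 1) mod d"
  have "d * s + b = n - 1" by (simp add: s_def b_def)
  then have "d * s + b + 1 = n" using assms(2) by linarith
  then have "real (d * s + b + 1) = real n" by (rule arg_cong)
  then have "real d * real s + real b + 1 = real n" by simp
  then have "real n / real d = real s + (real b + 1) / real d"
    using assms(1) by (simp add: field_simps)
  moreover have "(real b + 1) / real d \<le> 1"
  proof -
    have "b + 1 \<le> d" using mod_less_divisor[OF assms(1), of "n - 1"] by (simp add: b_def)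
    then have "real b + 1 \<le> real d" by linarith
    then show ?thesis using assms(1) by (simp add: divide_le_eq)
  qed
  moreover have "0 \<le> (real b + 1) / real d" by simp
  moreover have "real (child_index d i n) = real s + (if i < d - b then 0 else 1)"
    by (simp add: child_index_def s_def b_def)
  moreover have "0 \<le> (if i < d - b then 0 else 1 :: real)" "(if i < d - b then 0 else 1 :: real) \<le> 1"
    by simp_all
  ultimately show ?thesis by linarith
qed

lemma nleaves_H:
  assumes "2 \<le> d"
  shows "nleaves (Some (H d n)) = (d - 1) * n + 1"
proof (induction n rule: less_induct)
  case (less n)
  show ?case
  proof (cases "n = 0")
    case True
    then show ?thesis by (simp add: nleaves_Node)
  next
    case False
    have "nleaves (Some (H d n)) = (\<Sum>i<d. nleaves (Some (H d (child_index d i n))))"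
      using False assms by (simp add: H_eq_Node nleaves_Node)
    also have "\<dots> = (\<Sum>i<d. (d - 1) * child_index d i n + 1)"
    proof (rule sum.cong)
      fix i assume "i \<in> {..<d}"
      then have "child_index d i n < n" using two_child_index_le[OF assms, of i n] False by simp
      then show "nleaves (Some (H d (child_index d i n))) = (d - 1) * child_index d i n + 1"
        by (rule less.IH)
    qed simp
    also have "\<dots> = (d - 1) * (n - 1) + d"
      using assms sum_child_index[of d n]
      by (simp only: sum.distrib sum_distrib_left[symmetric]) simp
    also have "\<dots> = (d - 1) * n + 1"
    proof -
      obtain m where "n = Suc m" using False not0_implies_Suc by blast
      moreover obtain e where "d = Suc e" using assms by (cases d) simp_all
      ultimately show ?thesis by simp
    qed
    finally show ?thesis .
  qed
qed

subsection \<open>Convergence at rate 1/n\<close>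

text \<open>Carrying the rate along with the limit through all arithmetic yields convergence and the
  error term of the theorem together.\<close>

definition fast_limit :: "(nat \<Rightarrow> real) \<Rightarrow> real \<Rightarrow> bool" where
  "fast_limit u A \<longleftrightarrow> (\<lambda>n. u n - A) \<in> O(\<lambda>n. 1 / real n)"

lemma fast_limit_tendsto:
  assumes "fast_limit u A"
  shows "u \<longlonglongrightarrow> A"
proof -
  obtain c where "eventually (\<lambda>n. norm (u n - A) \<le> c * norm (1 / real n)) sequentially"
    using assms unfolding fast_limit_def by (elim landau_o.bigE)
  then have "eventually (\<lambda>n. norm (u n - A) \<le> norm (1 / real n) * c) sequentially"
    by (simp only: mult.commute)
  with lim_1_over_n[where 'a = real] have "(\<lambda>n. u n - A) \<longlonglongrightarrow> 0"
    by (rule tendsto_0_le)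
  then show ?thesis by (simp add: LIM_zero_iff)
qed

lemma tendsto_imp_bigo_1:
  fixes u :: "nat \<Rightarrow> real"
  assumes "u \<longlonglongrightarrow> A"
  shows "u \<in> O(\<lambda>_. 1)"
proof (rule bigoI_tendsto)
  show "((\<lambda>n. u n / 1) \<longlongrightarrow> A) sequentially" using assms by simp
qed simp

lemma fast_limit_unique: "fast_limit u A \<Longrightarrow> fast_limit u B \<Longrightarrow> A = B"
  using fast_limit_tendsto LIMSEQ_unique by blast

lemma fast_limit_cong:
  assumes "fast_limit u A" "eventually (\<lambda>n. u n = v n) sequentially"
  shows "fast_limit v A"
proof -
  have "(\<lambda>n. u n - A) \<in> O(\<lambda>n. 1 / real n) \<longleftrightarrow> (\<lambda>n. v n - A) \<in> O(\<lambda>n. 1 / real n)"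
    using assms(2) by (intro landau_o.big.in_cong) (auto elim: eventually_mono)
  then show ?thesis using assms(1) by (simp add: fast_limit_def)
qed

lemma fast_limitI:
  assumes "\<And>n. 0 < n \<Longrightarrow> \<bar>u n - A\<bar> \<le> c / real n"
  shows "fast_limit u A"
  unfolding fast_limit_def
  using assms by (intro bigoI[of _ c] eventually_sequentiallyI[of 1]) simp

text \<open>Adding the finitely many early errors to the constant makes the bound valid for every
  positive \<open>n\<close>, as the induction in the recurrence requires.\<close>

lemma fast_limitE:
  assumes "fast_limit u A"
  obtains c where "0 \<le> c" "\<And>n. 0 < n \<Longrightarrow> \<bar>u n - A\<bar> \<le> c / real n"
proof -
  obtain c where "eventually (\<lambda>n. norm (u n - A) \<le> c * norm (1 / real n)) sequentially"
    using assms unfolding fast_limit_def by (elim landau_o.bigE)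
  then obtain N where N: "\<And>n. n \<ge> N \<Longrightarrow> norm (u n - A) \<le> c * norm (1 / real n)"
    by (auto simp: eventually_sequentially)
  define c' where "c' = max c 0 + (\<Sum>n<N. \<bar>u n - A\<bar> * real n)"
  have sum_nonneg: "0 \<le> (\<Sum>n<N. \<bar>u n - A\<bar> * real n)" by (intro sum_nonneg) simp
  have "\<bar>u n - A\<bar> * real n \<le> c'" if "0 < n" for n
  proof (cases "n < N")
    case True
    then have "\<bar>u n - A\<bar> * real n \<le> (\<Sum>n<N. \<bar>u n - A\<bar> * real n)"
      by (intro member_le_sum) auto
    then show ?thesis by (simp add: c'_def)
  next
    case False
    then have "\<bar>u n - A\<bar> * real n \<le> c" using N[of n] that by (simp add: field_simps)
    then show ?thesis using sum_nonneg by (simp add: c'_def)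
  qed
  then have "\<bar>u n - A\<bar> \<le> c' / real n" if "0 < n" for n
    using that by (simp add: field_simps)
  moreover have "0 \<le> c'" using sum_nonneg by (simp add: c'_def)
  ultimately show thesis using that by blast
qed

lemma fast_limit_const: "fast_limit (\<lambda>_. A) A"
  by (simp add: fast_limit_def)

lemma fast_limit_add:
  assumes "fast_limit u A" "fast_limit v B"
  shows "fast_limit (\<lambda>n. u n + v n) (A + B)"
  using sum_in_bigo(1)[OF assms[unfolded fast_limit_def]]
  by (simp add: fast_limit_def algebra_simps)

lemma fast_limit_mult:
  assumes "fast_limit u A" "fast_limit v B"
  shows "fast_limit (\<lambda>n. u n * v n) (A * B)"
proof -
  have "(\<lambda>n. u n * (v n - B)) \<in> O(\<lambda>n. 1 * (1 / real n))"
    using tendsto_imp_bigo_1[OF fast_limit_tendsto[OF assms(1)]] assms(2) unfolding fast_limit_def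
    by (rule landau_o.big_mult)
  moreover have "(\<lambda>n. B * (u n - A)) \<in> O(\<lambda>n. 1 * (1 / real n))"
    using tendsto_imp_bigo_1[OF tendsto_const] assms(1) unfolding fast_limit_def
    by (rule landau_o.big_mult)
  ultimately have "(\<lambda>n. u n * (v n - B) + B * (u n - A)) \<in> O(\<lambda>n. 1 * (1 / real n))"
    by (rule sum_in_bigo(1))
  then show ?thesis by (simp add: fast_limit_def algebra_simps)
qed

lemma fast_limit_divide:
  assumes "fast_limit u A" "fast_limit v B" "B \<noteq> 0"
  shows "fast_limit (\<lambda>n. u n / v n) (A / B)"
proof -
  \<comment> \<open>The cofactor of \<open>v n - B\<close> in \<open>1 / v n - 1 / B\<close>; it
    converges and is therefore bounded.\<close>
  let ?w = "\<lambda>n. - inverse (B * v n)"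
  have v: "v \<longlonglongrightarrow> B" using assms(2) by (rule fast_limit_tendsto)
  have "?w \<longlonglongrightarrow> - inverse (B * B)"
    using assms(3) by (intro tendsto_minus tendsto_inverse tendsto_mult tendsto_const v) simp
  then have "?w \<in> O(\<lambda>_. 1)" by (rule tendsto_imp_bigo_1)
  then have *: "(\<lambda>n. ?w n * (v n - B)) \<in> O(\<lambda>n. 1 * (1 / real n))"
    using assms(2) unfolding fast_limit_def by (rule landau_o.big_mult)
  have "eventually (\<lambda>n. ?w n * (v n - B) = inverse (v n) - inverse B) sequentially"
    using tendsto_imp_eventually_ne[OF v assms(3)]
    by eventually_elim (use assms(3) in \<open>simp add: field_simps\<close>)
  from iffD1[OF landau_o.big.in_cong[OF this] *]
  have "fast_limit (\<lambda>n. inverse (v n)) (inverse B)" by (simp add: fast_limit_def)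
  from fast_limit_mult[OF assms(1) this] show ?thesis by (simp add: divide_inverse)
qed

lemma fast_limit_prod:
  assumes "finite I" "\<And>i. i \<in> I \<Longrightarrow> fast_limit (u i) (A i)"
  shows "fast_limit (\<lambda>n. \<Prod>i\<in>I. u i n) (\<Prod>i\<in>I. A i)"
  using assms by (induction I rule: finite_induct) (auto intro: fast_limit_mult fast_limit_const)

lemma fast_limit_sum:
  assumes "finite I" "\<And>i. i \<in> I \<Longrightarrow> fast_limit (u i) (A i)"
  shows "fast_limit (\<lambda>n. \<Sum>i\<in>I. u i n) (\<Sum>i\<in>I. A i)"
  using assms by (induction I rule: finite_induct) (auto intro: fast_limit_add fast_limit_const)

lemma fast_limit_power:
  assumes "fast_limit u A"
  shows "fast_limit (\<lambda>n. u n ^ k) (A ^ k)"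
  using fast_limit_prod[of "{..<k}" "\<lambda>_. u" "\<lambda>_. A"] assms by simp

section \<open>Limits along the indices of the branches\<close>

lemma fast_limit_child_index:
  assumes "0 < d"
  shows "fast_limit (\<lambda>n. real (child_index d i n) / real n) (1 / real d)"
proof (rule fast_limitI)
  fix n :: nat assume "0 < n"
  then have "real (child_index d i n) / real n - 1 / real d
      = (real (child_index d i n) - real n / real d) / real n"
    using assms by (simp add: field_simps)
  also have "\<bar>\<dots>\<bar> \<le> 2 / real n"
    using child_index_bounds[OF assms \<open>0 < n\<close>, of i] by (simp add: divide_right_mono)
  finally show "\<bar>real (child_index d i n) / real n - 1 / real d\<bar> \<le> 2 / real n" .
qed

text \<open>From \<open>4 * d\<close> on, the deviation 2 from \<open>n / d\<close> is at most half
  of \<open>n / d\<close>.\<close>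

lemma child_index_ge:
  assumes "0 < d" "4 * d \<le> n"
  shows "real n / (2 * real d) \<le> real (child_index d i n)"
proof -
  have "0 < n" using assms by simp
  have "4 * real d \<le> real n" using assms(2) by (metis of_nat_le_iff of_nat_mult of_nat_numeral)
  then have "2 \<le> real n / (2 * real d)" using assms(1) by (simp add: field_simps)
  moreover have "real n / real d = 2 * (real n / (2 * real d))" by simp
  ultimately show ?thesis using child_index_bounds[OF assms(1) \<open>0 < n\<close>, of i] by linarith
qed

lemma eventually_child_index_pos:
  assumes "0 < d"
  shows "eventually (\<lambda>n. 0 < child_index d i n) sequentially"
proof (rule eventually_sequentiallyI[of "4 * d"])
  fix n assume "4 * d \<le> n"
  moreover from this have "0 < real n / (2 * real d)" using assms by simp
  ultimately show "0 < child_index d i n" using child_index_ge[OF assms, of n i] by linarith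
qed

text \<open>The indices grow linearly in \<open>n\<close>, so the rate survives with the constant
  multiplied by \<open>2 * d\<close>.\<close>

lemma fast_limit_subseq_child_index:
  assumes "fast_limit u A" "0 < d"
  shows "fast_limit (\<lambda>n. u (child_index d i n)) A"
proof -
  obtain c where c: "0 \<le> c" "\<And>n. 0 < n \<Longrightarrow> \<bar>u n - A\<bar> \<le> c / real n"
    using assms(1) by (rule fast_limitE) blast
  have "\<bar>u (child_index d i n) - A\<bar> \<le> (2 * real d * c) * \<bar>1 / real n\<bar>" if n: "4 * d \<le> n" for n
  proof -
    have pos: "0 < real n / (2 * real d)" using n assms(2) by simp
    note ge = child_index_ge[OF assms(2) n, of i]
    then have "\<bar>u (child_index d i n) - A\<bar> \<le> c / real (child_index d i n)"
      using pos by (intro c(2)) linarith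
    also have "\<dots> \<le> c / (real n / (2 * real d))"
      by (intro divide_left_mono mult_pos_pos ge c(1) pos) (use ge pos in linarith)
    finally show ?thesis by (simp add: field_simps)
  qed
  then show ?thesis
    unfolding fast_limit_def by (intro bigoI[of _ "2 * real d * c"] eventually_sequentiallyI[of "4 * d"]) simp
qed

text \<open>The binomial coefficient is a product of \<open>k\<close> linear factors over
  \<open>fact k\<close>, and each factor divided by \<open>n\<close> tends to \<open>d - 1\<close>.
  The top entry is the number of leaves of \<open>H d n\<close>.\<close>

lemma fast_limit_choose:
  assumes "1 \<le> d"
  shows "fast_limit (\<lambda>n. real (((d - 1) * n + 1) choose k) / real n ^ k) ((real d - 1) ^ k / fact k)"
proof -
  have eq: "real ((d - 1) * n + 1) = (real d - 1) * real n + 1" for n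
  proof -
    have "real (d - 1) = real d - 1" using assms by (rule of_nat_diff[of 1 d, simplified of_nat_1])
    then show ?thesis by (simp only: of_nat_add of_nat_mult of_nat_1)
  qed
  have "fast_limit (\<lambda>n. (real ((d - 1) * n + 1) - real i) / real n) (real d - 1)" for i
  proof (rule fast_limitI)
    fix n :: nat assume "0 < n"
    then have "((real d - 1) * real n + 1 - real i) / real n - (real d - 1) = (1 - real i) / real n"
      by (simp add: field_simps)
    then show "\<bar>(real ((d - 1) * n + 1) - real i) / real n - (real d - 1)\<bar> \<le> \<bar>1 - real i\<bar> / real n"
      unfolding eq by simp
  qed
  then have "fast_limit (\<lambda>n. (\<Prod>i<k. (real ((d - 1) * n + 1) - real i) / real n) / fact k)
      ((\<Prod>i<k. real d - 1) / fact k)"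
    by (intro fast_limit_divide fast_limit_prod fast_limit_const) auto
  then show ?thesis
    by (simp only: binomial_gbinomial gbinomial_prod_rev prod_dividef atLeast0LessThan
        prod_constant card_lessThan divide_divide_eq_left mult.commute)
qed

subsection \<open>Asymptotics of the counts\<close>

definition norm_copies :: "nat \<Rightarrow> mtree option \<Rightarrow> nat \<Rightarrow> real" where
  "norm_copies d h n = real (type_copies h (H d n)) / real n ^ type_leaves h"

lemma fast_limit_lim: "fast_limit u A \<Longrightarrow> fast_limit u (lim u)"
  using fast_limit_tendsto limI by metis

lemma lim_fast_limit: "fast_limit u A \<Longrightarrow> lim u = A"
  using fast_limit_tendsto limI by metis

lemma norm_copies_None: "fast_limit (norm_copies d None) 1"
proof -
  have "norm_copies d None = (\<lambda>_. 1)"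
    by (intro ext) (simp add: norm_copies_def type_copies_None type_leaves_def)
  then show ?thesis by (simp add: fast_limit_const)
qed

lemma norm_copies_leaf:
  assumes "2 \<le> d"
  shows "fast_limit (norm_copies d (Some (MNode {#}))) (real d - 1)"
proof -
  have "norm_copies d (Some (MNode {#})) =
      (\<lambda>n. real (((d - 1) * n + 1) choose 1) / real n ^ 1)"
    by (intro ext) (simp add: norm_copies_def type_copies_leaf nleaves_H[OF assms] type_leaves_def)
  then show ?thesis using fast_limit_choose[of d 1] assms by simp
qed

lemma norm_copies_cherry:
  assumes "2 \<le> d"
  shows "fast_limit (norm_copies d (Some (MNode {#MNode {#}, MNode {#}#}))) ((real d - 1)\<^sup>2 / 2)"
proof -
  have "norm_copies d (Some (MNode {#MNode {#}, MNode {#}#})) =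
      (\<lambda>n. real (((d - 1) * n + 1) choose 2) / real n ^ 2)"
    by (intro ext) (simp add: norm_copies_def type_copies_cherry nleaves_H[OF assms] type_leaves_def
        numeral_2_eq_2)
  then show ?thesis using fast_limit_choose[of d 2] assms by (simp add: fact_2)
qed

lemma type_copies_H:
  assumes "2 \<le> size X" "size X \<le> d" "0 < n"
  shows "type_copies (Some (MNode X)) (H d n) =
    (\<Sum>i<d. type_copies (Some (MNode X)) (H d (child_index d i n))) +
    (\<Sum>hs\<in>permutations_of_multiset (branch_types d X).
       \<Prod>i<d. type_copies (hs ! i) (H d (child_index d i n)))"
proof -
  define ts where "ts = map (\<lambda>i. H d (child_index d i n)) [0..<d]"
  have "length ts = d" and nth: "\<And>i. i < d \<Longrightarrow> ts ! i = H d (child_index d i n)"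
    by (simp_all add: ts_def)
  moreover have "H d n = Node ts"
    using H_eq_Node[of d n] assms by (simp add: ts_def)
  ultimately show ?thesis
    using type_copies_Node[of X ts] assms(1,2) by simp
qed

lemma sum_nth_eq_sum_mset: "(\<Sum>i<length xs. f (xs ! i)) = sum_mset (image_mset f (mset xs))"
  by (simp add: sum_unfold_sum_mset image_mset_nth)

lemma prod_nth_eq_prod_mset: "(\<Prod>i<length xs. f (xs ! i)) = prod_mset (image_mset f (mset xs))"
  by (simp add: prod_unfold_prod_mset image_mset_nth)

lemma prod_mset_power: "prod_mset (image_mset (\<lambda>h. c ^ f h) M) = c ^ sum_mset (image_mset f M)"
  by (induction M) (simp_all add: power_add)

lemma sum_type_leaves_branch_types:
  assumes "X \<noteq> {#}"
  shows "sum_mset (image_mset type_leaves (branch_types d X)) = mleaves (MNode X)"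
proof -
  have "image_mset type_leaves (branch_types d X) = image_mset mleaves X + replicate_mset (d - size X) 0"
    by (simp add: branch_types_def image_mset.compositionality o_def type_leaves_def)
  then show ?thesis using assms by simp
qed

text \<open>With c the index of branch \<open>i\<close> and l the number of leaves of its type, each
  factor is the normalised count at c times (c/n)^l. The second part tends to d^(-l), and the
  exponents l add up to \<open>k\<close>.\<close>

lemma fast_limit_cross:
  assumes "0 < d" "length hs = d" "\<And>h. h \<in> set hs \<Longrightarrow> fast_limit (norm_copies d h) (\<alpha> h)"
  defines "k \<equiv> sum_mset (image_mset type_leaves (mset hs))"
  shows "fast_limit (\<lambda>n. (\<Prod>i<d. real (type_copies (hs ! i) (H d (child_index d i n)))) / real n ^ k)
    (prod_mset (image_mset \<alpha> (mset hs)) / real d ^ k)"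
proof -
  let ?l = "\<lambda>i. type_leaves (hs ! i)" and ?c = "\<lambda>i n. child_index d i n"
  have k: "k = (\<Sum>i<d. ?l i)"
    unfolding k_def assms(2)[symmetric] by (rule sum_nth_eq_sum_mset[symmetric])
  have \<alpha>: "prod_mset (image_mset \<alpha> (mset hs)) = (\<Prod>i<d. \<alpha> (hs ! i))"
    unfolding assms(2)[symmetric] by (rule prod_nth_eq_prod_mset[symmetric])
  have lim: "fast_limit (\<lambda>n. \<Prod>i<d. norm_copies d (hs ! i) (?c i n) * (real (?c i n) / real n) ^ ?l i)
      (\<Prod>i<d. \<alpha> (hs ! i) * (1 / real d) ^ ?l i)"
    using assms(1-3)
    by (intro fast_limit_prod fast_limit_mult fast_limit_power fast_limit_child_index
        fast_limit_subseq_child_index) auto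
  have limit_eq: "prod_mset (image_mset \<alpha> (mset hs)) / real d ^ k = (\<Prod>i<d. \<alpha> (hs ! i) * (1 / real d) ^ ?l i)"
    by (simp add: \<alpha> k prod.distrib power_sum power_one_over prod_dividef)
  have "eventually (\<lambda>n. (\<Prod>i<d. norm_copies d (hs ! i) (?c i n) * (real (?c i n) / real n) ^ ?l i)
      = (\<Prod>i<d. real (type_copies (hs ! i) (H d (?c i n)))) / real n ^ k) sequentially"
  proof -
    \<comment> \<open>Cancelling the powers of the branch indices requires them to be nonzero, which
      fails for small \<open>n\<close>.\<close>
    have "eventually (\<lambda>n. \<forall>i\<in>{..<d}. 0 < ?c i n) sequentially"
      using eventually_child_index_pos[OF assms(1)] by (intro eventually_ball_finite) auto
    then show ?thesis
    proof eventually_elim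
      case (elim n)
      have "(\<Prod>i<d. norm_copies d (hs ! i) (?c i n) * (real (?c i n) / real n) ^ ?l i)
          = (\<Prod>i<d. real (type_copies (hs ! i) (H d (?c i n))) / real n ^ ?l i)"
      proof (rule prod.cong)
        fix i assume "i \<in> {..<d}"
        then have "0 < ?c i n" using elim by blast
        then show "norm_copies d (hs ! i) (?c i n) * (real (?c i n) / real n) ^ ?l i
            = real (type_copies (hs ! i) (H d (?c i n))) / real n ^ ?l i"
          by (simp add: norm_copies_def power_divide)
      qed simp
      then show ?case by (simp add: k prod_dividef power_sum)
    qed
  qed
  with lim show ?thesis unfolding limit_eq by (rule fast_limit_cong)
qed

lemma power_gt_self:
  assumes "2 \<le> d" "2 \<le> k"
  shows "real d < real d ^ k"
  using power_strict_increasing[of 1 k "real d"] assms by simp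

text \<open>The indices of the children add up to \<open>n - 1\<close> and are at most \<open>n / 2\<close>, so that for \<open>k \<ge> 3\<close>
  an error term of order \<open>n ^ (k - 1)\<close> is at least halved by the recursion.\<close>

lemma fast_limit_recurrence:
  fixes a p :: "nat \<Rightarrow> real"
  assumes "2 \<le> d" "3 \<le> k" "a 0 = 0"
    and rec: "\<And>n. 0 < n \<Longrightarrow> a n = (\<Sum>i<d. a (child_index d i n)) + p n"
    and p: "fast_limit (\<lambda>n. p n / real n ^ k) (C / real d ^ k)"
  shows "fast_limit (\<lambda>n. a n / real n ^ k) (C / (real d ^ k - real d))"
proof -
  define A where "A = C / (real d ^ k - real d)"
  have pos: "0 < real d ^ k - real d" "0 < real d" using power_gt_self[of d k] assms by simp_all
  obtain m where k: "k = m + 3" using assms(2) by (metis add.commute le_Suc_ex)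
  \<comment> \<open>Inserting \<open>A * n ^ k\<close> into the right-hand side of the recurrence
    reproduces it up to a relative error of order \<open>1 / n\<close>.\<close>
  have "fast_limit (\<lambda>n. p n / real n ^ k + (\<Sum>i<d. A * (real (child_index d i n) / real n) ^ k))
      (C / real d ^ k + (\<Sum>i<d. A * (1 / real d) ^ k))"
    using assms(1) by (intro fast_limit_add fast_limit_sum fast_limit_mult fast_limit_power
        fast_limit_child_index fast_limit_const p) auto
  moreover have "C / real d ^ k + (\<Sum>i<d. A * (1 / real d) ^ k) = A"
  proof -
    have "C = A * (real d ^ k - real d)" using pos by (simp add: A_def)
    then show ?thesis using pos by (simp add: power_one_over field_simps)
  qed
  ultimately have "fast_limit (\<lambda>n. p n / real n ^ k
      + (\<Sum>i<d. A * (real (child_index d i n) / real n) ^ k)) A" by simp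
  then obtain K where K: "0 \<le> K" and r: "\<And>n. 0 < n \<Longrightarrow>
      \<bar>p n / real n ^ k + (\<Sum>i<d. A * (real (child_index d i n) / real n) ^ k) - A\<bar> \<le> K / real n"
    by (rule fast_limitE) blast
  define e where "e n = a n - A * real n ^ k" for n
  \<comment> \<open>The constant \<open>2 * K\<close> reproduces itself: half of it comes from the
    branches after halving, the other half from the residual \<open>?q\<close>.\<close>
  have e_le: "\<bar>e n\<bar> \<le> 2 * K * real n ^ (m + 2)" for n
  proof (induction n rule: less_induct)
    case (less n)
    show ?case
    proof (cases "n = 0")
      case True
      then show ?thesis using assms(3) by (simp add: e_def k)
    next
      case False
      then have n: "0 < n" by simp
      let ?c = "\<lambda>i. child_index d i n"
      let ?q = "p n / real n ^ k + (\<Sum>i<d. A * (real (?c i) / real n) ^ k) - A"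
      have "?q * real n ^ k = p n + (\<Sum>i<d. A * real (?c i) ^ k) - A * real n ^ k"
        using n by (simp add: algebra_simps sum_distrib_right sum_distrib_left power_divide)
      then have e: "e n = (\<Sum>i<d. e (?c i)) + ?q * real n ^ k"
        unfolding e_def rec[OF n] by (simp add: sum_subtractf)
      have c_le: "\<bar>e (?c i)\<bar> \<le> K * real n ^ (m + 1) * real (?c i)" if "i < d" for i
      proof -
        have half: "2 * ?c i \<le> n" using two_child_index_le[OF assms(1) that n] .
        then have c: "real (?c i) \<le> real n / 2" "real (?c i) \<le> real n" by linarith+
        \<comment> \<open>Of the \<open>m + 2 = k - 1\<close> factors, one is kept because the
          indices sum to \<open>n - 1\<close>, one gains the factor 1/2, and the rest are bounded by
          \<open>n\<close>. This is where \<open>3 \<le> k\<close> enters.\<close>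
        have "real (?c i) ^ (m + 2) = real (?c i) * (real (?c i) * real (?c i) ^ m)" by simp
        also have "\<dots> \<le> real (?c i) * (real n / 2 * real n ^ m)"
          using c by (intro mult_left_mono mult_mono power_mono) simp_all
        finally have "2 * K * real (?c i) ^ (m + 2) \<le> 2 * K * (real (?c i) * (real n / 2 * real n ^ m))"
          using K by (intro mult_left_mono) simp_all
        also have "\<dots> = K * real n ^ (m + 1) * real (?c i)" by simp
        finally show ?thesis
          using less.IH[of "?c i"] half n by linarith
      qed
      have "\<bar>\<Sum>i<d. e (?c i)\<bar> \<le> (\<Sum>i<d. K * real n ^ (m + 1) * real (?c i))"
        using c_le by (intro sum_mono[THEN order_trans[OF sum_abs]]) simp
      also have "\<dots> = K * real n ^ (m + 1) * real (n - 1)"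
        using sum_child_index[of d n] assms(1)
        by (simp only: sum_distrib_left[symmetric] of_nat_sum[symmetric])
      also have "\<dots> \<le> K * real n ^ (m + 1) * real n"
        using K by (intro mult_left_mono) simp_all
      finally have "\<bar>\<Sum>i<d. e (?c i)\<bar> \<le> K * real n ^ (m + 2)" by (simp add: mult_ac)
      moreover have "\<bar>?q * real n ^ k\<bar> \<le> K * real n ^ (m + 2)"
      proof -
        have "\<bar>?q\<bar> * real n ^ k \<le> K / real n * real n ^ k"
          using r[OF n] by (intro mult_right_mono) simp_all
        then show ?thesis using n by (simp add: abs_mult k numeral_3_eq_3 numeral_2_eq_2)
      qed
      ultimately show ?thesis unfolding e by linarith
    qed
  qed
  have "\<bar>a n / real n ^ k - A\<bar> \<le> 2 * K / real n" if "0 < n" for n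
  proof -
    have "\<bar>a n / real n ^ k - A\<bar> = \<bar>e n\<bar> / real n ^ k"
      using that by (simp add: e_def field_simps flip: abs_div_pos)
    also have "\<dots> \<le> 2 * K * real n ^ (m + 2) / real n ^ k"
      by (intro divide_right_mono e_le) simp
    also have "\<dots> = 2 * K / real n"
      using that by (simp add: k numeral_3_eq_3 numeral_2_eq_2)
    finally show ?thesis .
  qed
  then show ?thesis unfolding A_def by (rule fast_limitI)
qed

text \<open>Read off from the branch recursion at \<open>n = 1\<close>: all \<open>d\<close>
  branches of \<open>H d 1\<close> are single leaves, so each arrangement contributes 1, while every
  pair among the \<open>d\<close> leaves is a copy.\<close>

lemma card_permutations_cherry:
  assumes "2 \<le> d"
  shows "card (permutations_of_multiset (branch_types d {#MNode {#}, MNode {#}#})) = d choose 2"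
proof -
  let ?X = "{#MNode {#}, MNode {#}#}"
  let ?P = "permutations_of_multiset (branch_types d ?X)"
  have idx: "child_index d i 1 = 0" if "i < d" for i
    using that by (simp add: child_index_def)
  have one: "type_copies (hs ! i) Leaf = 1" if "hs \<in> ?P" "i < d" for hs i
  proof -
    have hs: "mset hs = branch_types d ?X" using that(1) by (rule permutations_of_multisetD)
    then have "size (mset hs) = d" using assms by (simp add: branch_types_def)
    then have "hs ! i \<in> set hs" using that(2) by simp
    then have "hs ! i \<in># branch_types d ?X" by (simp flip: hs)
    then have "hs ! i = None \<or> hs ! i = Some (MNode {#})"
      by (auto simp: branch_types_def split: if_splits)
    then show ?thesis
      by (elim disjE) (simp_all add: type_copies_None type_copies_leaf nleaves_Node)
  qed
  have "(d choose 2) = type_copies (Some (MNode ?X)) (H d 1)"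
    using assms by (simp only: type_copies_cherry nleaves_H) simp
  also have "\<dots> = (\<Sum>i<d. type_copies (Some (MNode ?X)) Leaf) + (\<Sum>hs\<in>?P. \<Prod>i<d. type_copies (hs ! i) Leaf)"
    using type_copies_H[of ?X d 1] assms idx by simp
  also have "\<dots> = card ?P"
    using one by (simp add: type_copies_Leaf)
  finally show ?thesis by simp
qed

text \<open>For at least three leaves this is the recurrence with the arrangements as inhomogeneity.
  For two leaves the exact count has limit (d-1)^2/2, which agrees with the formula since d(d-1)/2
  times (d-1)^2 divided by d^2 - d is the same number.\<close>

lemma fast_limit_norm_copies_Node:
  assumes d: "2 \<le> d" and X: "2 \<le> size X" and m: "mdary d (MNode X)"
    and \<alpha>: "\<And>h. h \<in># branch_types d X \<Longrightarrow> fast_limit (norm_copies d h) (\<alpha> h)"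
  shows "fast_limit (norm_copies d (Some (MNode X)))
    (real (card (permutations_of_multiset (branch_types d X))) * prod_mset (image_mset \<alpha> (branch_types d X))
      / (real d ^ mleaves (MNode X) - real d))"
    (is "fast_limit _ (real (card ?P) * ?\<alpha> / _)")
proof -
  have "X \<noteq> {#}" and size_le: "size X \<le> d" using X m by auto
  define k where "k = mleaves (MNode X)"
  have "2 \<le> k" using X size_le_sum_mleaves[of X] \<open>X \<noteq> {#}\<close> by (simp add: k_def)
  have k_sum: "sum_mset (image_mset type_leaves (branch_types d X)) = k"
    using sum_type_leaves_branch_types[OF \<open>X \<noteq> {#}\<close>] by (simp only: k_def)
  show ?thesis
  proof (cases "k = 2")
    case True
    then have "MNode X = MNode {#MNode {#}, MNode {#}#}"
      using mleaves_eq_2 mdary_imp_no_unary[OF m] by (simp only: k_def)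
    then have X_eq: "X = {#MNode {#}, MNode {#}#}" by simp
    \<comment> \<open>\<open>\<alpha>\<close> is known only as a limit; uniqueness of limits gives
      its values at the two possible entries.\<close>
    have "\<alpha> h = (real d - 1) ^ type_leaves h" if "h \<in># branch_types d X" for h
    proof -
      have "h = None \<or> h = Some (MNode {#})"
        using that by (auto simp: branch_types_def X_eq split: if_splits)
      then show ?thesis
      proof
        assume "h = None"
        then show ?thesis using fast_limit_unique[OF \<alpha>[OF that]] norm_copies_None
          by (simp add: type_leaves_def)
      next
        assume "h = Some (MNode {#})"
        then show ?thesis using fast_limit_unique[OF \<alpha>[OF that]] norm_copies_leaf[OF d]
          by (simp add: type_leaves_def)
      qed
    qed
    then have "image_mset \<alpha> (branch_types d X) = image_mset (\<lambda>h. (real d - 1) ^ type_leaves h) (branch_types d X)"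
      by (intro image_mset_cong) simp
    then have "?\<alpha> = (real d - 1) ^ 2"
      using k_sum True by (simp add: prod_mset_power)
    moreover have "real (card ?P) = real d * (real d - 1) / 2"
      unfolding X_eq card_permutations_cherry[OF d]
      by (simp add: binomial_gbinomial gbinomial_prod_rev numeral_2_eq_2)
    moreover have "0 < real d ^ 2 - real d" using power_gt_self[OF d, of 2] by simp
    ultimately have eq: "real (card ?P) * ?\<alpha> / (real d ^ k - real d) = (real d - 1)\<^sup>2 / 2"
      using True by (simp add: divide_eq_eq) (simp add: power2_eq_square algebra_simps)
    have "fast_limit (norm_copies d (Some (MNode X))) ((real d - 1)\<^sup>2 / 2)"
      using norm_copies_cherry[OF d] by (simp only: X_eq)
    then show ?thesis unfolding k_def[symmetric] eq .
  next
    case False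
    let ?p = "\<lambda>n. \<Sum>hs\<in>?P. \<Prod>i<d. real (type_copies (hs ! i) (H d (child_index d i n)))"
    have "fast_limit (\<lambda>n. \<Sum>hs\<in>?P. (\<Prod>i<d. real (type_copies (hs ! i) (H d (child_index d i n)))) / real n ^ k)
        (\<Sum>hs\<in>?P. ?\<alpha> / real d ^ k)"
    proof (rule fast_limit_sum)
      fix hs assume "hs \<in> ?P"
      then have hs: "mset hs = branch_types d X" by (rule permutations_of_multisetD)
      have len: "length hs = d"
        using arg_cong[OF hs, of size] size_le by (simp add: branch_types_def)
      have lim: "fast_limit (norm_copies d h) (\<alpha> h)" if "h \<in> set hs" for h
        using that hs by (intro \<alpha>) (metis set_mset_mset)
      have "0 < d" using d by simp
      from fast_limit_cross[OF this len lim]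
      show "fast_limit (\<lambda>n. (\<Prod>i<d. real (type_copies (hs ! i) (H d (child_index d i n)))) / real n ^ k)
          (?\<alpha> / real d ^ k)"
        unfolding hs k_sum .
    qed simp
    then have "fast_limit (\<lambda>n. ?p n / real n ^ k) (real (card ?P) * ?\<alpha> / real d ^ k)"
      by (simp add: sum_divide_distrib)
    then have "fast_limit (\<lambda>n. real (type_copies (Some (MNode X)) (H d n)) / real n ^ k)
        (real (card ?P) * ?\<alpha> / (real d ^ k - real d))"
    proof (rule fast_limit_recurrence[OF d, rotated 3])
      show "3 \<le> k" using False \<open>2 \<le> k\<close> by linarith
      show "real (type_copies (Some (MNode X)) (H d 0)) = 0"
        using \<open>X \<noteq> {#}\<close> by (simp add: type_copies_Leaf)
      show "real (type_copies (Some (MNode X)) (H d n)) =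
          (\<Sum>i<d. real (type_copies (Some (MNode X)) (H d (child_index d i n)))) + ?p n" if "0 < n" for n
        unfolding type_copies_H[OF X size_le that] by simp
    qed
    then show ?thesis
      unfolding norm_copies_def type_leaves_def k_def by simp
  qed
qed

text \<open>Structural induction on the type, in which \<open>lim\<close> supplies the limits of the
  branches to the preceding recursion.\<close>

lemma fast_limit_norm_copies:
  assumes "2 \<le> d" "\<And>m. h = Some m \<Longrightarrow> mdary d m"
  shows "fast_limit (norm_copies d h) (lim (norm_copies d h))"
proof -
  have ex: "\<exists>A. fast_limit (norm_copies d (Some m)) A" if "mdary d m" for m
    using that
  proof (induction m)
    case (MNode X)
    show ?case
    proof (cases "X = {#}")
      case True
      then show ?thesis using norm_copies_leaf[OF assms(1)] by blast
    next
      case False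
      have lim: "fast_limit (norm_copies d h) (lim (norm_copies d h))" if "h \<in># branch_types d X" for h
      proof (cases h)
        case None
        then show ?thesis using norm_copies_None fast_limit_lim by blast
      next
        case (Some x)
        then have "x \<in># X" using that by (auto simp: branch_types_def split: if_splits)
        moreover from this have "mdary d x" using MNode.prems by simp
        ultimately show ?thesis using MNode.IH Some fast_limit_lim by blast
      qed
      have size: "2 \<le> size X" using False MNode.prems by simp
      from fast_limit_norm_copies_Node[OF assms(1) size MNode.prems lim] show ?thesis
        by (rule exI)
    qed
  qed
  show ?thesis
  proof (cases h)
    case None
    then show ?thesis using fast_limit_lim[OF norm_copies_None] by simp
  next
    case (Some m)
    then obtain A where "fast_limit (norm_copies d h) A"
      using ex assms(2) by blast
    then show ?thesis by (rule fast_limit_lim)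
  qed
qed

section \<open>From normalised counts to densities and the stated formula\<close>

lemma fast_limit_density:
  assumes d: "2 \<le> d" and m: "\<And>m. map_option canon D = Some m \<Longrightarrow> mdary d m"
  shows "fast_limit (\<lambda>n. density D (Some (H d n)))
    (lim (norm_copies d (map_option canon D)) * fact (nleaves D) / (real d - 1) ^ nleaves D)"
proof -
  let ?h = "map_option canon D" and ?k = "nleaves D"
  \<comment> \<open>Numerator and denominator of the density are both divided by
    \<open>n ^ ?k\<close>.\<close>
  have "fast_limit (\<lambda>n. norm_copies d ?h n / (real (((d - 1) * n + 1) choose ?k) / real n ^ ?k))
      (lim (norm_copies d ?h) / ((real d - 1) ^ ?k / fact ?k))"
    using d by (intro fast_limit_divide fast_limit_norm_copies fast_limit_choose m) auto
  moreover have "eventually (\<lambda>n. norm_copies d ?h n / (real (((d - 1) * n + 1) choose ?k) / real n ^ ?k)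
      = density D (Some (H d n))) sequentially"
  proof (rule eventually_sequentiallyI[of 1])
    fix n :: nat assume "1 \<le> n"
    then show "norm_copies d ?h n / (real (((d - 1) * n + 1) choose ?k) / real n ^ ?k)
      = density D (Some (H d n))"
      by (simp add: norm_copies_def density_def copies_eq_type_copies type_leaves_canon nleaves_H[OF d])
  qed
  ultimately have "fast_limit (\<lambda>n. density D (Some (H d n)))
      (lim (norm_copies d ?h) / ((real d - 1) ^ ?k / fact ?k))"
    by (rule fast_limit_cong)
  then show ?thesis by simp
qed

text \<open>Two permutations are equivalent exactly if they rearrange the list of branch types into
  the same list, and every arrangement of these types comes from a permutation. Representatives thus
  correspond to arrangements.\<close>

lemma card_perm_reps:
  assumes "perm_reps d D M" "length (branches d D) = d"
  shows "card M = card (permutations_of_multiset (mset (map (map_option canon) (branches d D))))"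
proof -
  define hs where "hs = map (map_option canon) (branches d D)"
  have len: "length hs = d" using assms(2) by (simp add: hs_def)
  have M: "\<And>\<pi>. \<pi> \<in> M \<Longrightarrow> \<pi> permutes {..<d}"
    "\<And>\<pi>. \<pi> permutes {..<d} \<Longrightarrow> \<exists>!\<pi>'. \<pi>' \<in> M \<and> perm_sim d D \<pi> \<pi>'"
    using assms(1) by (auto simp: perm_reps_def)
  have sim: "perm_sim d D \<pi> \<pi>' \<longleftrightarrow> permute_list \<pi> hs = permute_list \<pi>' hs"
    if "\<pi> permutes {..<d}" "\<pi>' permutes {..<d}" for \<pi> \<pi>'
  proof -
    have "permute_list \<pi> hs = permute_list \<pi>' hs \<longleftrightarrow> (\<forall>j<d. hs ! \<pi> j = hs ! \<pi>' j)"
      using that by (simp add: list_eq_iff_nth_eq len permute_list_nth)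
    also have "\<dots> \<longleftrightarrow> perm_sim d D \<pi> \<pi>'"
      using permutes_in_image[OF that(1)] permutes_in_image[OF that(2)] assms(2)
      by (simp add: perm_sim_def iso_iff_canon hs_def)
    finally show ?thesis by simp
  qed
  have "bij_betw (\<lambda>\<pi>. permute_list \<pi> hs) M (permutations_of_multiset (mset hs))"
    unfolding bij_betw_def
  proof (intro conjI equalityI subsetI inj_onI)
    fix \<pi> \<pi>' assume \<pi>: "\<pi> \<in> M" "\<pi>' \<in> M" "permute_list \<pi> hs = permute_list \<pi>' hs"
    then have "perm_sim d D \<pi> \<pi>" "perm_sim d D \<pi> \<pi>'" using sim M(1) by blast+
    then show "\<pi> = \<pi>'" using \<pi>(1,2) M(2)[OF M(1)[OF \<pi>(1)]] by blast
  next
    fix xs assume "xs \<in> (\<lambda>\<pi>. permute_list \<pi> hs) ` M"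
    then show "xs \<in> permutations_of_multiset (mset hs)"
      using M(1) len by (auto intro!: permutations_of_multisetI)
  next
    fix xs assume "xs \<in> permutations_of_multiset (mset hs)"
    then have "mset xs = mset hs" by (rule permutations_of_multisetD)
    then obtain \<pi> where \<pi>: "\<pi> permutes {..<d}" "permute_list \<pi> hs = xs"
      using mset_eq_permutation len by metis
    then obtain \<pi>' where "\<pi>' \<in> M" "perm_sim d D \<pi> \<pi>'" using M(2) by blast
    then show "xs \<in> (\<lambda>\<pi>. permute_list \<pi> hs) ` M"
      using sim[OF \<pi>(1) M(1)] \<pi>(2) by auto
  qed
  then show ?thesis unfolding hs_def by (rule bij_betw_same_card)
qed

theorem theorem2:
  fixes d :: nat and D :: tree
  assumes "d \<ge> 2" and "dary d D"
  shows "convergent (\<lambda>n. density D (Some (H d n))) \<and>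
    (D = None \<or> D = Some Leaf \<longrightarrow> \<eta> d D = 1) \<and>
    (D \<noteq> None \<and> D \<noteq> Some Leaf \<longrightarrow>
      (\<forall>M. perm_reps d D M \<longrightarrow>
        \<eta> d D = multinomial (nleaves D) (\<lambda>i. nleaves (branches d D ! i)) d
                 * (real (card M) / (real d ^ nleaves D - real d))
                 * (\<Prod>i<d. \<eta> d (branches d D ! i)))) \<and>
    (\<lambda>n. density D (Some (H d n)) - \<eta> d D) \<in> O(\<lambda>n. 1 / real n)"
proof -
  let ?L = "\<lambda>T. lim (norm_copies d (map_option canon T))"
  have m: "mdary d m" if "map_option canon D = Some m" for m
    using that assms(2) mdary_canon by (cases D) auto
  \<comment> \<open>Stated for arbitrary \<open>T\<close> since it is used for \<open>D\<close> and
    for each of its branches, including the empty ones.\<close>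
  have \<eta>: "\<eta> d T = ?L T * fact (nleaves T) / (real d - 1) ^ nleaves T"
    if "\<And>m. map_option canon T = Some m \<Longrightarrow> mdary d m" for T
    unfolding \<eta>_def using lim_fast_limit[OF fast_limit_density[OF assms(1) that]] .
  have \<eta>_D: "\<eta> d D = ?L D * fact (nleaves D) / (real d - 1) ^ nleaves D"
    by (rule \<eta>) (rule m)
  have lim: "fast_limit (\<lambda>n. density D (Some (H d n))) (\<eta> d D)"
    unfolding \<eta>_def by (rule fast_limit_lim[OF fast_limit_density[OF assms(1) m]])
  have "convergent (\<lambda>n. density D (Some (H d n)))"
    using fast_limit_tendsto[OF lim] by (rule convergentI)
  moreover have "\<eta> d D = 1" if "D = None \<or> D = Some Leaf"
    using that
  proof
    assume "D = None"
    moreover have "nleaves None = 0" by (simp add: nleaves_def leaves_def)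
    ultimately show ?thesis
      using \<eta>_D lim_fast_limit[OF norm_copies_None] by simp
  next
    assume "D = Some Leaf"
    then show ?thesis
      using \<eta>_D lim_fast_limit[OF norm_copies_leaf[OF assms(1)]] assms(1)
      by (simp add: nleaves_Node)
  qed
  moreover have "\<eta> d D = multinomial (nleaves D) (\<lambda>i. nleaves (branches d D ! i)) d
                 * (real (card M) / (real d ^ nleaves D - real d))
                 * (\<Prod>i<d. \<eta> d (branches d D ! i))"
    if D: "D \<noteq> None" "D \<noteq> Some Leaf" and M: "perm_reps d D M" for M
  proof -
    obtain ds where ds: "D = Some (Node ds)" "ds \<noteq> []"
      using D by (metis option.exhaust rtree.exhaust)
    define X where "X = mset (map canon ds)"
    have mX: "mdary d (MNode X)" using m ds(1) by (simp add: X_def)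
    have X: "2 \<le> size X" "size X \<le> d" "X \<noteq> {#}" using mX ds(2) by (auto simp: X_def)
    have "length ds \<le> d" using X(2) by (simp add: X_def)
    then have len: "length (branches d D) = d" by (simp add: ds(1))
    have mset_branches: "mset (map (map_option canon) (branches d D)) = branch_types d X"
      by (simp add: ds(1) branch_types_def X_def image_mset.compositionality o_def)
    have branch_mdary: "mdary d m" if "h \<in># branch_types d X" "h = Some m" for h m
      using that mX by (auto simp: branch_types_def split: if_splits)
    have branch: "mdary d m" if "i < d" "map_option canon (branches d D ! i) = Some m" for i m
    proof -
      have "map_option canon (branches d D ! i) \<in># mset (map (map_option canon) (branches d D))"
        using that(1) len by simp
      then show ?thesis using branch_mdary that(2) unfolding mset_branches by blast
    qed
    let ?k = "nleaves D" and ?l = "\<lambda>i. nleaves (branches d D ! i)"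
    let ?\<alpha> = "\<lambda>h. lim (norm_copies d h)"
    have k: "?k = mleaves (MNode X)"
      using mleaves_canon[of "Node ds"] ds(1) by (simp add: X_def)
    have "?k = sum_mset (image_mset type_leaves (branch_types d X))"
      unfolding k sum_type_leaves_branch_types[OF X(3)] ..
    also have "\<dots> = (\<Sum>i<d. type_leaves (map (map_option canon) (branches d D) ! i))"
      unfolding mset_branches[symmetric] sum_nth_eq_sum_mset[symmetric] by (simp add: len)
    also have "\<dots> = (\<Sum>i<d. ?l i)"
      by (intro sum.cong) (simp_all add: len type_leaves_canon)
    finally have k_sum: "?k = (\<Sum>i<d. ?l i)" .
    have "prod_mset (image_mset ?\<alpha> (branch_types d X)) =
        (\<Prod>i<d. ?\<alpha> (map (map_option canon) (branches d D) ! i))"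
      unfolding mset_branches[symmetric] prod_nth_eq_prod_mset[symmetric] by (simp add: len)
    also have "\<dots> = (\<Prod>i<d. ?L (branches d D ! i))"
      by (intro prod.cong) (simp_all add: len)
    finally have prod: "prod_mset (image_mset ?\<alpha> (branch_types d X)) = (\<Prod>i<d. ?L (branches d D ! i))" .
    have branch_lim: "fast_limit (norm_copies d h) (?\<alpha> h)" if "h \<in># branch_types d X" for h
      using fast_limit_norm_copies[OF assms(1)] branch_mdary[OF that] by blast
    have card_M: "card M = card (permutations_of_multiset (branch_types d X))"
      using card_perm_reps[OF M len] by (simp only: mset_branches)
    have type_D: "map_option canon D = Some (MNode X)" by (simp add: ds(1) X_def)
    have L: "?L D = real (card M) * (\<Prod>i<d. ?L (branches d D ! i)) / (real d ^ ?k - real d)"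
      unfolding type_D card_M prod[symmetric] k
      by (rule lim_fast_limit[OF fast_limit_norm_copies_Node[OF assms(1) X(1) mX branch_lim]])
    \<comment> \<open>Since the \<open>?l i\<close> sum to \<open>?k\<close>, the powers of
      \<open>d - 1\<close> here cancel against the one in \<open>\<eta>_D\<close>, and the product
      of factorials cancels the denominator of \<open>multinomial\<close>.\<close>
    have "(\<Prod>i<d. \<eta> d (branches d D ! i)) =
        (\<Prod>i<d. ?L (branches d D ! i) * fact (?l i) / (real d - 1) ^ ?l i)"
      by (intro prod.cong \<eta>) (use branch in auto)
    also have "\<dots> = (\<Prod>i<d. ?L (branches d D ! i)) * (\<Prod>i<d. fact (?l i)) / (real d - 1) ^ ?k"
      by (simp add: prod.distrib prod_dividef k_sum power_sum)
    finally have prod_\<eta>: "(\<Prod>i<d. \<eta> d (branches d D ! i)) =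
        (\<Prod>i<d. ?L (branches d D ! i)) * (\<Prod>i<d. fact (?l i)) / (real d - 1) ^ ?k" .
    have "(\<Prod>i<d. fact (?l i)) \<noteq> (0::real)" by simp
    then show ?thesis
      unfolding \<eta>_D prod_\<eta> L multinomial_def by simp
  qed
  ultimately show ?thesis using lim unfolding fast_limit_def by blast
qed

end
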